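(* Let $k \geqslant 0$ be an integer, and let $\gamma \in \mathbb{R}$. If \[ \liminf_{q \to \infty} \|q\gamma\| \exp^{(k+3)}(q^{7000}) < \infty, \] where $q$ runs over the positive integers, then there exists $S \subseteq \mathbb{N}$ such that \[ \sum_{q \in S} f_k(q) = \infty, \qquad \lambda(W(\mathbf{1}_S f_k, \gamma)) = 0. \]
   Context: $\mathbb{N}$ denotes the positive integers and $\lambda$ denotes Lebesgue measure on $\mathbb{R}$. For $x \in \mathbb{R}$, $\|x\| = \min\{|x-a| : a \in \mathbb{Z}\}$. For $j \geqslant 0$, $\exp^{(j)}$ denotes the $j$th iterate of $\exp$, and $\log^{(j)}$ denotes the $j$th iterate of the function $x \mapsto \max\{1, \log x\}$. For each integer $k \geqslant 0$, $f_k: \mathbb{N} \to (0,\infty)$ is the function \[ f_k(q) = \frac{1}{q \, (\log^{(1)} q)(\log^{(2)} q) \cdots (\log^{(k)} q)}, \] so that $f_0(q) = 1/q$. For $\psi: \mathbb{N} \to [0,\infty)$ and $\gamma \in \mathbb{R}$, \[ W(\psi,\gamma) = \{\alpha \in [0,1] : \|q\alpha - \gamma\| < \psi(q) \text{ for infinitely many } q \in \mathbb{N}\}. \] $\mathbf{1}_S$ denotes the indicator function of $S$, and $\mathbf{1}_S f_k$ is the pointwise product. *)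

theory Defs
  imports "HOL-Analysis.Analysis"
begin

definition int_dist :: "real \<Rightarrow> real"
  where "int_dist x = (INF a\<in>(\<int> :: real set). \<bar>x - a\<bar>)"

text \<open>The infimum defining \<^const>\<open>int_dist\<close> is a minimum.\<close>

lemma int_dist_attained: "\<exists>a\<in>\<int>. int_dist x = \<bar>x - a\<bar>"
proof -
  let ?a = "real_of_int (round x)"
  have "int_dist x = \<bar>x - ?a\<bar>"
    unfolding int_dist_def
  proof (rule cInf_eq_minimum)
    show "\<bar>x - ?a\<bar> \<in> (\<lambda>a. \<bar>x - a\<bar>) ` \<int>" by simp
    fix d
    assume "d \<in> (\<lambda>a. \<bar>x - a\<bar>) ` \<int>"
    then obtain m :: int where "d = \<bar>x - of_int m\<bar>" by (auto elim: Ints_cases)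
    then show "\<bar>x - ?a\<bar> \<le> d"
      using round_diff_minimal[of x m] by (simp add: abs_minus_commute)
  qed
  then show ?thesis by (intro bexI[of _ ?a]) auto
qed

definition iter_log :: "nat \<Rightarrow> real \<Rightarrow> real"
  where "iter_log j = (\<lambda>x. max 1 (ln x)) ^^ j"

definition iter_exp :: "nat \<Rightarrow> real \<Rightarrow> real"
  where "iter_exp j = exp ^^ j"

text \<open>
  Functions on the positive integers are modelled as functions on \<^typ>\<open>nat\<close>; the value at
  \<open>0\<close> is never used.
\<close>

definition f_log :: "nat \<Rightarrow> nat \<Rightarrow> real"
  where "f_log k q = 1 / (real q * (\<Prod>j=1..k. iter_log j (real q)))"

definition W_set :: "(nat \<Rightarrow> real) \<Rightarrow> real \<Rightarrow> real set"
  where "W_set \<psi> \<gamma> =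
    {\<alpha> \<in> {0..1}. infinite {q :: nat. q \<ge> 1 \<and> int_dist (real q * \<alpha> - \<gamma>) < \<psi> q}}"

end

theory Submission
  imports Defs "HOL-Number_Theory.Number_Theory" "HOL-Library.Discrete_Functions"
    "HOL-Real_Asymp.Real_Asymp"
begin

text \<open>
  Choose \<open>b\<close> with \<open>\<gamma>\<close> extremely close to \<open>a / b\<close>. In a range of \<open>q\<close> where this error is at
  most \<open>f_log k q\<close>, the points \<open>\<alpha>\<close> approximated with denominator \<open>q\<close> lie within
  \<open>2 f_log k q / q\<close> of a fraction \<open>(a + c b) / (b q)\<close>. The set \<open>S\<close> is a union of finite blocks
  of \<open>q\<close>; each block has a large sum of \<open>f_log k\<close>, but its fractions coincide so often that the
  union of the intervals has tiny measure.

  The coincidences come from exchanging primes. Let \<open>p' < p \<le> 2 p'\<close> be primes with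
  \<open>p' \<equiv> p\<close> modulo \<open>b\<close>. If \<open>p\<close> divides both \<open>q\<close> and \<open>n = a + c b\<close>, then
  \<open>n / (b q)\<close> equals \<open>(n p' / p) / (b (q p' / p))\<close>, whose numerator is still congruent to \<open>a\<close>,
  whose denominator is smaller and whose interval is therefore at least as large
  (\<open>exchange_prime\<close>). A block consists of the \<open>q\<close> divisible by at least one prime of each pair in
  a system of disjoint pairs, a property preserved by the exchange. Hence, apart from the \<open>q\<close>
  at the very beginning of the block, only those fractions have to be covered for which no
  larger prime \<open>p\<close> of a pair divides both \<open>q\<close> and \<open>n\<close>
  (\<open>exchange_descent\<close>, \<open>ex_small_cover\<close>). By the Chinese remainder theorem their proportion
  is on average at most \<open>exp (- (\<Sum> 1 / p) / 3)\<close>, the sum being over the larger primes of the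
  pairs (\<open>avoid_count_le\<close>).

  All primes between \<open>b\<close> and about \<open>exp (b ^ 2)\<close> are coprime to \<open>b\<close>, and their
  reciprocals have a sum of at least \<open>ln b / 2\<close> (\<open>ln_le_exp_sum_primes\<close>). Pairing them
  greedily loses only a constant factor and a bounded amount (\<open>ex_prime_pairs\<close>), so the
  proportion above tends to \<open>0\<close> as \<open>b\<close> grows.
  If \<open>N\<close> is the product of the primes used, a block has density at least \<open>1 / N\<close>, and the sum
  of \<open>f_log k\<close> over it exceeds \<open>K\<close> once \<open>q\<close> reaches about
  \<open>iter_exp (k + 1) ((K + 2) N)\<close> (\<open>ex_block_length\<close>). Since \<open>(K + 2) N\<close> is far below
  \<open>exp (exp (b ^ 7000))\<close>, the hypothesis makes \<open>\<bar>\<gamma> - a / b\<bar>\<close> small enough on the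
  whole block (\<open>ex_block\<close>). Taking blocks with \<open>K = n + 1\<close> and covers of measure at most
  \<open>2 ^ (- n)\<close>, the Borel-Cantelli lemma gives the theorem.
\<close>

section \<open>Iterated logarithms and exponentials\<close>

lemma iter_log_Suc: "iter_log (Suc j) x = max 1 (ln (iter_log j x))"
  by (simp add: iter_log_def)

lemma iter_exp_Suc: "iter_exp (Suc j) x = exp (iter_exp j x)"
  by (simp add: iter_exp_def)

lemma iter_log_0 [simp]: "iter_log 0 x = x"
  by (simp add: iter_log_def)

lemma iter_exp_0 [simp]: "iter_exp 0 x = x"
  by (simp add: iter_exp_def)

lemma iter_log_ge_1: "x \<ge> 1 \<Longrightarrow> iter_log j x \<ge> 1"
  by (cases j) (auto simp: iter_log_Suc)

lemma iter_log_mono: "1 \<le> x \<Longrightarrow> x \<le> y \<Longrightarrow> iter_log j x \<le> iter_log j y"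
proof (induction j)
  case (Suc j)
  moreover have "iter_log j x \<ge> 1" using Suc.prems iter_log_ge_1 by simp
  ultimately have "ln (iter_log j x) \<le> ln (iter_log j y)" by (intro ln_mono) auto
  then show ?case by (auto simp: iter_log_Suc)
qed simp

lemma iter_log_le_self: "x \<ge> 1 \<Longrightarrow> iter_log j x \<le> x"
proof (induction j)
  case (Suc j)
  moreover have "ln (iter_log j x) \<le> iter_log j x - 1"
    using iter_log_ge_1[of x j] Suc.prems by (intro ln_le_minus_one) auto
  ultimately show ?case by (auto simp: iter_log_Suc)
qed simp

lemma iter_log_iter_exp: "x \<ge> 1 \<Longrightarrow> iter_log j (iter_exp j x) = x"
proof (induction j arbitrary: x)
  case (Suc j)
  have "iter_exp (Suc j) x = iter_exp j (exp x)"
    by (simp add: iter_exp_def funpow_swap1)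
  moreover have "exp x \<ge> 1" using Suc.prems by simp
  ultimately show ?case using Suc by (simp add: iter_log_Suc)
qed simp

lemma iter_exp_ge_self: "iter_exp j x \<ge> x"
proof (induction j)
  case (Suc j)
  have "exp (iter_exp j x) \<ge> 1 + iter_exp j x" by (rule exp_ge_add_one_self)
  with Suc show ?case unfolding iter_exp_Suc by linarith
qed simp

lemma iter_exp_mono: "x \<le> y \<Longrightarrow> iter_exp j x \<le> iter_exp j y"
  by (induction j) (auto simp: iter_exp_Suc)

lemma iter_exp_mult_le:
  assumes "c \<ge> 1" "x \<ge> 1"
  shows "c * iter_exp j x \<le> iter_exp j (c * x)"
proof (induction j)
  case (Suc j)
  have 1: "iter_exp j x \<ge> 1" using iter_exp_ge_self[of x j] assms by linarith
  have "c \<le> exp (c - 1)" using exp_ge_add_one_self[of "c - 1"] by simp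
  also have "\<dots> \<le> exp ((c - 1) * iter_exp j x)"
    using 1 assms by (simp add: mult_le_cancel_left1)
  finally have "c * exp (iter_exp j x) \<le> exp ((c - 1) * iter_exp j x) * exp (iter_exp j x)"
    by simp
  also have "\<dots> = exp (c * iter_exp j x)"
    by (simp add: exp_add[symmetric] algebra_simps)
  also have "\<dots> \<le> exp (iter_exp j (c * x))" using Suc by simp
  finally show ?case by (simp add: iter_exp_Suc)
qed simp

lemma iter_exp_add: "iter_exp (i + j) x = iter_exp i (iter_exp j x)"
  by (simp add: iter_exp_def funpow_add)

lemma power_iter_exp_le:
  assumes "x \<ge> 1"
  shows "iter_exp (Suc j) x ^ Suc n \<le> iter_exp (Suc j) (real (Suc n) * x)"
proof -
  have "iter_exp (Suc j) x ^ Suc n = exp (real (Suc n) * iter_exp j x)"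
    by (simp only: iter_exp_Suc exp_of_nat_mult)
  also have "\<dots> \<le> iter_exp (Suc j) (real (Suc n) * x)"
    using iter_exp_mult_le[of "real (Suc n)" x j] assms by (simp only: iter_exp_Suc exp_le_cancel_iff)
  finally show ?thesis .
qed

lemma prod_iter_log_ge_1: "x \<ge> 1 \<Longrightarrow> (\<Prod>j=1..k. iter_log j x) \<ge> 1"
  by (intro prod_ge_1 iter_log_ge_1)

lemma f_log_denominator_pos: "q \<ge> 1 \<Longrightarrow> real q * (\<Prod>j=1..k. iter_log j (real q)) > 0"
  using prod_iter_log_ge_1[of "real q" k] by (intro mult_pos_pos) linarith+

lemma f_log_pos: "q \<ge> 1 \<Longrightarrow> f_log k q > 0"
  unfolding f_log_def by (intro divide_pos_pos f_log_denominator_pos) auto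

lemma f_log_antimono:
  assumes "1 \<le> q" "q \<le> r"
  shows "f_log k r \<le> f_log k q"
proof -
  have "real q * (\<Prod>j=1..k. iter_log j (real q)) \<le> real r * (\<Prod>j=1..k. iter_log j (real r))"
    using assms
    by (intro mult_mono prod_mono)
       (auto intro!: prod_nonneg iter_log_mono order_trans[OF zero_le_one iter_log_ge_1])
  then show ?thesis
    using f_log_denominator_pos[of q k] f_log_denominator_pos[of r k] assms
    unfolding f_log_def by (intro frac_le) auto
qed

lemma f_log_le:
  assumes "q \<ge> 1"
  shows "f_log k q \<le> 1 / real q"
proof -
  have "real q \<le> real q * (\<Prod>j=1..k. iter_log j (real q))"
    using prod_iter_log_ge_1[of "real q" k] assms by (simp add: mult_le_cancel_left1)
  then show ?thesis
    using f_log_denominator_pos[of q k] assms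
    unfolding f_log_def by (intro frac_le) auto
qed

lemma f_log_ge:
  assumes "q \<ge> 1"
  shows "f_log k q \<ge> 1 / real q ^ Suc k"
proof -
  have "(\<Prod>j=1..k. iter_log j (real q)) \<le> (\<Prod>j=1..k. real q)"
    using assms
    by (intro prod_mono) (auto intro: iter_log_le_self order_trans[OF zero_le_one iter_log_ge_1])
  then have "real q * (\<Prod>j=1..k. iter_log j (real q)) \<le> real q ^ Suc k"
    by (simp add: mult_left_mono)
  then show ?thesis
    using f_log_denominator_pos[of q k] assms
    unfolding f_log_def by (intro frac_le) auto
qed

text \<open>
  Since \<open>ln s - ln t \<le> (s - t) / t\<close>, the function \<open>iter_log (k + 1)\<close> grows at rate at most
  \<open>f_log k\<close>. Summing this inequality replaces the integral comparison for \<open>f_log k\<close>.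
\<close>

lemma iter_log_diff_le:
  assumes "1 \<le> x" "x \<le> y"
  shows "iter_log (Suc k) y - iter_log (Suc k) x
          \<le> (y - x) / (x * (\<Prod>j=1..k. iter_log j x))"
proof (induction k)
  have step: "max 1 (ln t) - max 1 (ln s) \<le> (t - s) / s" if "1 \<le> s" "s \<le> t" for s t :: real
  proof -
    have "ln t - ln s = ln (t / s)" using that by (simp add: ln_div)
    also have "\<dots> \<le> t / s - 1" using that by (intro ln_le_minus_one) auto
    also have "\<dots> = (t - s) / s" using that by (simp add: field_simps)
    finally have "ln t - ln s \<le> (t - s) / s" .
    moreover have "(t - s) / s \<ge> 0" using that by auto
    moreover have "ln s \<le> ln t" using that by (intro ln_mono) auto
    ultimately show ?thesis by linarith
  qed
  case 0
  then show ?case using step[of x y] assms by (simp add: iter_log_Suc)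
  case (Suc k)
  let ?s = "iter_log (Suc k) x" and ?t = "iter_log (Suc k) y"
  have "?s \<ge> 1" using assms by (intro iter_log_ge_1)
  moreover have "?s \<le> ?t" using assms by (intro iter_log_mono)
  ultimately have "iter_log (Suc (Suc k)) y - iter_log (Suc (Suc k)) x \<le> (?t - ?s) / ?s"
    using step[of ?s ?t] by (simp add: iter_log_Suc)
  also have "\<dots> \<le> ((y - x) / (x * (\<Prod>j=1..k. iter_log j x))) / ?s"
    using Suc \<open>?s \<ge> 1\<close> by (intro divide_right_mono) auto
  also have "\<dots> = (y - x) / (x * (\<Prod>j=1..Suc k. iter_log j x))"
    by (simp add: field_simps)
  finally show ?case .
qed

lemma sum_f_log_multiples_ge:
  assumes "N \<ge> 1" "m \<ge> 1"
  shows "(\<Sum>j=2..m. real N * f_log k (N * j))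
          \<ge> iter_log (Suc k) (real (N * Suc m)) - iter_log (Suc k) (real (2 * N))"
  using assms(2)
proof (induction m rule: dec_induct)
  case base
  then show ?case by (simp add: numeral_2_eq_2)
next
  case (step m)
  have "iter_log (Suc k) (real (N * Suc (Suc m))) - iter_log (Suc k) (real (N * Suc m))
      \<le> (real (N * Suc (Suc m)) - real (N * Suc m))
          / (real (N * Suc m) * (\<Prod>j=1..k. iter_log j (real (N * Suc m))))"
  proof (rule iter_log_diff_le)
    have "1 \<le> N * Suc m" using assms(1) by simp
    then show "1 \<le> real (N * Suc m)" by linarith
  qed (simp add: algebra_simps)
  also have "\<dots> = real N * f_log k (N * Suc m)"
    by (simp add: f_log_def algebra_simps)
  finally have "iter_log (Suc k) (real (N * Suc (Suc m))) - iter_log (Suc k) (real (N * Suc m))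
      \<le> real N * f_log k (N * Suc m)" .
  moreover have "(\<Sum>j=2..Suc m. real N * f_log k (N * j))
     = (\<Sum>j=2..m. real N * f_log k (N * j)) + real N * f_log k (N * Suc m)"
    using step by simp
  ultimately show ?case using step.IH by linarith
qed

section \<open>Reciprocals of primes\<close>

lemma ln_le_iff: "x > 0 \<Longrightarrow> ln x \<le> y \<longleftrightarrow> x \<le> exp y" for x y :: real
  by (metis exp_le_cancel_iff exp_ln)
lemma inverse_of_nat_le_1: "1 / real n \<le> 1"
  by (cases n) auto

text \<open>
  A truncated Euler product. An integer in the sum that has a prime factor \<open>p\<close> is \<open>p\<close> times an
  integer of the same kind, which bounds the sum over \<open>insert p P\<close> by the sum over \<open>P\<close> plus
  \<open>1 / p\<close> times itself.
\<close>

lemma sum_inverse_smooth_le: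
  fixes P :: "nat set"
  assumes "finite P" "\<And>p. p \<in> P \<Longrightarrow> prime p"
  shows "(\<Sum>n | n \<in> {1..y} \<and> prime_factors n \<subseteq> P. 1 / real n) * (\<Prod>p\<in>P. 1 - 1 / real p) \<le> 1"
  using assms
proof (induction P)
  case empty
  have "{n. n \<in> {1..y} \<and> prime_factors n \<subseteq> {}} \<subseteq> {1}"
    by (auto simp: prime_factorization_empty_iff)
  then have "(\<Sum>n | n \<in> {1..y} \<and> prime_factors n \<subseteq> {}. 1 / real n) \<le> (\<Sum>n\<in>{1::nat}. 1 / real n)"
    by (intro sum_mono2) auto
  then show ?case by simp
next
  case (insert p P)
  let ?A = "\<lambda>P. {n. n \<in> {1..y} \<and> prime_factors n \<subseteq> P}"
  let ?T = "\<lambda>P. \<Sum>n\<in>?A P. 1 / real n"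
  have p: "prime p" using insert by auto
  have fin: "finite (?A P)" for P by simp
  have "?A (insert p P) \<subseteq> ?A P \<union> (\<lambda>m. p * m) ` ?A (insert p P)"
  proof
    fix n assume n: "n \<in> ?A (insert p P)"
    show "n \<in> ?A P \<union> (\<lambda>m. p * m) ` ?A (insert p P)"
    proof (cases "p dvd n")
      case True
      then obtain m where m: "n = p * m" by auto
      have "m \<noteq> 0" using n m by (auto)
      then have "prime_factors m \<subseteq> prime_factors n"
        using n m by (intro dvd_prime_factors) auto
      moreover have "m \<le> n" using m prime_ge_1_nat[OF p] by simp
      moreover have "n \<le> y" "prime_factors n \<subseteq> insert p P" using n by auto
      ultimately have "m \<in> ?A (insert p P)" using \<open>m \<noteq> 0\<close> by (simp add: subset_trans)
      then show ?thesis using m by blast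
    next
      case False
      then have "p \<notin> prime_factors n" by auto
      then show ?thesis using n by auto
    qed
  qed
  then have "?T (insert p P) \<le> (\<Sum>n\<in>?A P \<union> (\<lambda>m. p * m) ` ?A (insert p P). 1 / real n)"
    by (intro sum_mono2) auto
  also have "\<dots> \<le> ?T P + (\<Sum>n\<in>(\<lambda>m. p * m) ` ?A (insert p P). 1 / real n)"
    by (subst sum_Un) (auto intro!: sum_nonneg)
  also have "(\<Sum>n\<in>(\<lambda>m. p * m) ` ?A (insert p P). 1 / real n)
      = (\<Sum>m\<in>?A (insert p P). 1 / real (p * m))"
    using p prime_gt_0_nat by (subst sum.reindex) (auto simp: inj_on_def)
  also have "\<dots> = 1 / real p * ?T (insert p P)"
    by (simp add: sum_distrib_left)
  finally have 1: "?T (insert p P) * (1 - 1 / real p) \<le> ?T P"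
    by (simp add: algebra_simps)
  have nonneg: "(\<Prod>p\<in>P. 1 - 1 / real p) \<ge> 0"
    by (intro prod_nonneg) (simp add: inverse_of_nat_le_1)
  have "?T (insert p P) * (\<Prod>p\<in>insert p P. 1 - 1 / real p)
     = (?T (insert p P) * (1 - 1 / real p)) * (\<Prod>p\<in>P. 1 - 1 / real p)"
    using insert.hyps by (simp add: mult_ac)
  also have "\<dots> \<le> ?T P * (\<Prod>p\<in>P. 1 - 1 / real p)"
    using 1 nonneg by (intro mult_right_mono)
  also have "\<dots> \<le> 1" using insert.IH insert.prems by auto
  finally show ?case .
qed

text \<open>
  A crude substitute for Mertens' theorem. The primes up to \<open>b\<close> contribute at most the
  telescoping product \<open>(\<Prod>n=2..b. n / (n - 1)) = b\<close> to the Euler product up to \<open>y\<close>, and the latter is at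
  least \<open>ln y\<close>.
\<close>

lemma ln_le_exp_sum_primes:
  assumes "b \<ge> 1" "y \<ge> 1"
  shows "ln (real y) \<le> real b * exp (2 * (\<Sum>p | prime p \<and> b < p \<and> p \<le> y. 1 / real p))"
proof -
  define P where "P = {p::nat. prime p \<and> p \<le> y}"
  define Q where "Q = {p::nat. prime p \<and> b < p \<and> p \<le> y}"
  define R where "R = {p::nat. prime p \<and> p \<le> y \<and> p \<le> b}"
  have fin: "finite P" "finite Q" "finite R"
    by (auto simp: P_def Q_def R_def intro: finite_subset[of _ "{..y}"])
  have small: "(\<Prod>p\<in>R. 1 - 1 / real p) \<ge> 1 / real b"
  proof -
    have "1 / real b = (\<Prod>n=2..b. 1 - 1 / real n)"
      using assms(1)
    proof (induction b rule: dec_induct)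
      case (step n)
      then show ?case by (simp add: field_simps)
    qed simp
    also have "\<dots> \<le> (\<Prod>p\<in>R. 1 - 1 / real p)"
    proof -
      have "R \<subseteq> {2..b}" by (auto simp: R_def prime_ge_2_nat)
      then have "(\<Prod>n=2..b. 1 - 1 / real n)
          = (\<Prod>n\<in>{2..b} - R. 1 - 1 / real n) * (\<Prod>n\<in>R. 1 - 1 / real n)"
        by (intro prod.subset_diff) auto
      also have "\<dots> \<le> 1 * (\<Prod>n\<in>R. 1 - 1 / real n)"
        by (intro mult_right_mono prod_le_1 prod_nonneg) (auto simp: inverse_of_nat_le_1)
      finally show ?thesis by simp
    qed
    finally show ?thesis .
  qed
  have big: "(\<Prod>p\<in>Q. 1 - 1 / real p) \<ge> exp (- 2 * (\<Sum>p\<in>Q. 1 / real p))"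
  proof -
    have "exp (- 2 * (\<Sum>p\<in>Q. 1 / real p)) = (\<Prod>p\<in>Q. exp (- 2 * (1 / real p)))"
      by (simp add: sum_distrib_left exp_sum fin)
    also have "\<dots> \<le> (\<Prod>p\<in>Q. 1 - 1 / real p)"
    proof (intro prod_mono conjI)
      fix p assume "p \<in> Q"
      then have p: "p \<ge> 2" by (auto simp: Q_def prime_ge_2_nat)
      define x where "x = 1 / real p"
      have x: "0 < x" "x \<le> 1 / 2" using p by (auto simp: x_def field_simps)
      have "exp (2 * x) * (1 - x) \<ge> (1 + 2 * x) * (1 - x)"
        using x exp_ge_add_one_self[of "2 * x"] by (intro mult_right_mono) auto
      also have "(1 + 2 * x) * (1 - x) = 1 + x * (1 - 2 * x)" by (simp add: algebra_simps)
      also have "\<dots> \<ge> 1" using x by simp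
      finally have "exp (- 2 * x) \<le> 1 - x"
        by (simp add: exp_minus field_simps)
      then show "exp (- 2 * (1 / real p)) \<le> 1 - 1 / real p" by (simp add: x_def)
    qed auto
    finally show ?thesis .
  qed
  have "ln (real y) \<le> harm y"
    using assms(2) ln_mono[of "real y" "real y + 1"] ln_le_harm[of y] by linarith
  also have "harm y = (\<Sum>n\<in>{n. n \<in> {1..y} \<and> prime_factors n \<subseteq> P}. 1 / real n)"
  proof -
    have "{n. n \<in> {1..y} \<and> prime_factors n \<subseteq> P} = {1..y}"
    proof -
      have "p \<in> P" if "n \<in> {1..y}" "p \<in> prime_factors n" for n p
      proof -
        have "p dvd n" "prime p" using that by auto
        then have "p \<le> n" using that by (intro dvd_imp_le) auto
        with \<open>prime p\<close> that show ?thesis by (simp add: P_def)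
      qed
      then show ?thesis by blast
    qed
    then show ?thesis by (simp add: harm_def inverse_eq_divide)
  qed
  finally have "ln (real y) \<le> (\<Sum>n\<in>{n. n \<in> {1..y} \<and> prime_factors n \<subseteq> P}. 1 / real n)" .
  then have "ln (real y) * (\<Prod>p\<in>P. 1 - 1 / real p)
      \<le> (\<Sum>n\<in>{n. n \<in> {1..y} \<and> prime_factors n \<subseteq> P}. 1 / real n) * (\<Prod>p\<in>P. 1 - 1 / real p)"
    by (intro mult_right_mono prod_nonneg) (auto simp: inverse_of_nat_le_1)
  also have "\<dots> \<le> 1"
    using fin(1) by (intro sum_inverse_smooth_le) (auto simp: P_def)
  finally have 1: "ln (real y) * (\<Prod>p\<in>P. 1 - 1 / real p) \<le> 1" .
  have "P = R \<union> Q" "R \<inter> Q = {}" by (auto simp: P_def R_def Q_def)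
  then have "(\<Prod>p\<in>P. 1 - 1 / real p) = (\<Prod>p\<in>R. 1 - 1 / real p) * (\<Prod>p\<in>Q. 1 - 1 / real p)"
    using fin by (simp add: prod.union_disjoint)
  also have "\<dots> \<ge> 1 / real b * exp (- 2 * (\<Sum>p\<in>Q. 1 / real p))"
    using small big by (intro mult_mono prod_nonneg) (auto simp: inverse_of_nat_le_1)
  finally have "ln (real y) * (1 / real b * exp (- 2 * (\<Sum>p\<in>Q. 1 / real p)))
      \<le> ln (real y) * (\<Prod>p\<in>P. 1 - 1 / real p)"
    using assms by (intro mult_left_mono) auto
  then have "ln (real y) * (1 / real b * exp (- 2 * (\<Sum>p\<in>Q. 1 / real p))) \<le> 1"
    using 1 by linarith
  then show ?thesis
    using assms by (simp add: exp_minus field_simps Q_def)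
qed

section \<open>Pairs of congruent primes\<close>

text \<open>
  A finite system of disjoint pairs \<open>(p', p)\<close> of primes exceeding \<open>b\<close>, with
  \<open>p' < p \<le> 2 p'\<close> and \<open>p' \<equiv> p\<close> modulo \<open>b\<close>. The smaller prime is the first component.
\<close>

definition prime_pairs :: "nat \<Rightarrow> (nat \<times> nat) set \<Rightarrow> bool"
  where "prime_pairs b M \<longleftrightarrow> finite M \<and>
    (\<forall>x\<in>M. prime (fst x) \<and> prime (snd x) \<and> b < fst x \<and> fst x < snd x \<and> snd x \<le> 2 * fst x \<and>
      [fst x = snd x] (mod b)) \<and>
    (\<forall>x\<in>M. \<forall>y\<in>M. x \<noteq> y \<longrightarrow> {fst x, snd x} \<inter> {fst y, snd y} = {})"

text \<open>
  The key \<open>(p mod b, j)\<close> with \<open>2 ^ j b \<le> p < 2 ^ (j + 1) b\<close> determines an element of a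
  separated set, and \<open>1 / (2 ^ j b)\<close> sums to at most \<open>2\<close> over all keys.
\<close>

lemma sum_inverse_le_2:
  fixes A :: "nat set"
  assumes "finite A" "b \<ge> 1" "\<And>p. p \<in> A \<Longrightarrow> b < p"
    and sep: "\<And>p q. p \<in> A \<Longrightarrow> q \<in> A \<Longrightarrow> p < q \<Longrightarrow> [p = q] (mod b) \<Longrightarrow> 2 * p < q"
  shows "(\<Sum>p\<in>A. 1 / real p) \<le> 2"
proof -
  define key where "key = (\<lambda>p. (p mod b, floor_log (p div b)))"
  have lower: "b * 2 ^ snd (key p) \<le> p" and upper: "p < 2 * (b * 2 ^ snd (key p))"
    if "p \<in> A" for p
  proof -
    have pos: "p div b > 0" using that assms(2) assms(3)[of p] by (simp add: div_greater_zero_iff)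
    have "b * 2 ^ snd (key p) \<le> b * (p div b)"
      using pos floor_log_exp2_le[OF pos] by (simp add: key_def)
    also have "\<dots> \<le> p" by simp
    finally show "b * 2 ^ snd (key p) \<le> p" .
    have "p div b < 2 * 2 ^ snd (key p)"
      using floor_log_exp2_gt[where n = "p div b"] by (simp add: key_def)
    then have "p div b + 1 \<le> 2 * 2 ^ snd (key p)" by simp
    then have "b * (p div b + 1) \<le> b * (2 * 2 ^ snd (key p))" by (intro mult_le_mono2)
    moreover have "p < b * (p div b + 1)"
      using assms(2) by (simp add: dividend_less_times_div)
    ultimately show "p < 2 * (b * 2 ^ snd (key p))" by simp
  qed
  have inj: "inj_on key A"
  proof (rule linorder_inj_onI)
    fix p q assume *: "p < q" "p \<in> A" "q \<in> A"
    show "key p \<noteq> key q"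
    proof
      assume eq: "key p = key q"
      then have "[p = q] (mod b)" by (simp add: key_def cong_def)
      then have "2 * p < q" using sep * by blast
      moreover have "q < 2 * p"
        using upper[of q] lower[of p] * eq by simp
      ultimately show False by simp
    qed
  qed auto
  define J where "J = Max (insert 0 (snd ` key ` A))"
  have sub: "key ` A \<subseteq> {..<b} \<times> {..J}"
  proof
    fix x assume "x \<in> key ` A"
    then obtain p where p: "p \<in> A" "x = key p" by auto
    then have "snd x \<le> J" unfolding J_def using assms(1) by (intro Max_ge) auto
    moreover have "fst x < b" using p assms(2) by (simp add: key_def)
    ultimately show "x \<in> {..<b} \<times> {..J}" by (simp add: mem_Times_iff)
  qed
  have "(\<Sum>p\<in>A. 1 / real p) \<le> (\<Sum>p\<in>A. 1 / real (b * 2 ^ snd (key p)))"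
    using lower assms(2) by (intro sum_mono frac_le) (auto simp del: of_nat_mult of_nat_power)
  also have "\<dots> = (\<Sum>x\<in>key ` A. 1 / real (b * 2 ^ snd x))"
    using inj by (simp add: sum.reindex)
  also have "\<dots> \<le> (\<Sum>x\<in>{..<b} \<times> {..J}. 1 / real (b * 2 ^ snd x))"
    using sub by (intro sum_mono2) auto
  also have "\<dots> = (\<Sum>(r, j)\<in>{..<b} \<times> {..J}. 1 / real b * (1 / 2) ^ j)"
    by (intro sum.cong) (auto simp: power_divide)
  also have "\<dots> = (\<Sum>r\<in>{..<b}. \<Sum>j\<in>{..J}. 1 / real b * (1 / 2) ^ j)"
    by (rule sum.cartesian_product[symmetric])
  also have "\<dots> = (\<Sum>j\<in>{..J}. (1 / 2) ^ j)"
    using assms(2) by (simp add: sum_divide_distrib[symmetric])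
  also have "\<dots> \<le> 2"
  proof -
    have "(\<Sum>j\<in>{..J}. (1 / 2) ^ j) \<le> (\<Sum>j. (1 / 2 :: real) ^ j)"
      by (intro sum_le_suminf) auto
    then show ?thesis by (simp add: suminf_geometric)
  qed
  finally show ?thesis .
qed

text \<open>
  Pairs are removed greedily. When no pair can be formed any more, two remaining primes in the
  same class modulo \<open>b\<close> differ by a factor of more than \<open>2\<close>, so what is left has a bounded sum
  of reciprocals.
\<close>

lemma ex_prime_pairs:
  fixes A :: "nat set"
  assumes "finite A" "b \<ge> 1" "\<And>p. p \<in> A \<Longrightarrow> prime p \<and> b < p"
  shows "\<exists>M. prime_pairs b M \<and> M \<subseteq> A \<times> A \<and>
           (\<Sum>p\<in>A. 1 / real p) \<le> 2 + 3 * (\<Sum>x\<in>M. 1 / real (snd x))"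
  using assms(1,3)
proof (induction "card A" arbitrary: A rule: less_induct)
  case less
  show ?case
  proof (cases "\<exists>p\<in>A. \<exists>q\<in>A. p < q \<and> [p = q] (mod b) \<and> q \<le> 2 * p")
    case False
    then have "(\<Sum>p\<in>A. 1 / real p) \<le> 2"
      using less.prems assms(2) by (intro sum_inverse_le_2[of A b]) (auto simp: not_le)
    moreover have "prime_pairs b {}" by (simp add: prime_pairs_def)
    ultimately show ?thesis by (intro exI[of _ "{}"]) auto
  next
    case True
    then obtain p q where pq: "p \<in> A" "q \<in> A" "p < q" "[p = q] (mod b)" "q \<le> 2 * p" by auto
    define B where "B = A - {p, q}"
    have "card B < card A"
      using pq less.prems(1) unfolding B_def by (intro psubset_card_mono) auto
    then obtain M where M: "prime_pairs b M" "M \<subseteq> B \<times> B"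
        "(\<Sum>p\<in>B. 1 / real p) \<le> 2 + 3 * (\<Sum>x\<in>M. 1 / real (snd x))"
      using less.hyps[of B] less.prems unfolding B_def by (auto simp del: sum_divide_distrib)
    have fin: "finite M" using M(1) by (simp add: prime_pairs_def)
    have notin: "(p, q) \<notin> M" using M(2) by (auto simp: B_def)
    have disj: "{p, q} \<inter> {fst x, snd x} = {}" if "x \<in> M" for x
      using that M(2) by (auto simp: B_def)
    have "prime_pairs b (insert (p, q) M)"
      unfolding prime_pairs_def
    proof (intro conjI ballI impI)
      fix x y assume "x \<in> insert (p, q) M" "y \<in> insert (p, q) M" "x \<noteq> y"
      then consider "x = (p, q)" "y \<in> M" | "x \<in> M" "y = (p, q)" | "x \<in> M" "y \<in> M"
        by auto
      then show "{fst x, snd x} \<inter> {fst y, snd y} = {}"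
      proof cases
        case 1
        then show ?thesis using disj[of y] by simp
      next
        case 2
        then show ?thesis using disj[of x] by auto
      next
        case 3
        then show ?thesis using M(1) \<open>x \<noteq> y\<close> unfolding prime_pairs_def by blast
      qed
    qed (use M(1) pq less.prems in \<open>auto simp: prime_pairs_def\<close>)
    moreover have "insert (p, q) M \<subseteq> A \<times> A" using M(2) pq by (auto simp: B_def)
    moreover have "(\<Sum>p\<in>A. 1 / real p) \<le> 2 + 3 * (\<Sum>x\<in>insert (p, q) M. 1 / real (snd x))"
    proof -
      have "A = insert p (insert q B)" "p \<notin> insert q B" "q \<notin> B" "finite B"
        using pq less.prems(1) by (auto simp: B_def)
      then have "(\<Sum>p\<in>A. 1 / real p) = 1 / real p + (1 / real q + (\<Sum>p\<in>B. 1 / real p))"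
        by simp
      moreover have "1 / real p \<le> 2 / real q"
        using pq prime_gt_0_nat less.prems by (simp add: field_simps)
      ultimately show ?thesis using M(3) fin notin by simp
    qed
    ultimately show ?thesis by blast
  qed
qed

section \<open>Averages of periodic functions\<close>

lemma sum_mult_periodic_coprime:
  fixes u v :: "nat \<Rightarrow> real"
  assumes "coprime m n" "m > 0" "n > 0"
    and u: "\<And>q. u (q mod m) = u q" and v: "\<And>q. v (q mod n) = v q"
  shows "(\<Sum>q<m * n. u q * v q) = (\<Sum>q<m. u q) * (\<Sum>q<n. v q)"
proof -
  let ?h = "\<lambda>q. (q mod m, q mod n)"
  have inj: "inj_on ?h {..<m * n}"
  proof (rule inj_onI)
    fix x y assume *: "x \<in> {..<m * n}" "y \<in> {..<m * n}" "?h x = ?h y"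
    then have "[x = y] (mod m)" "[x = y] (mod n)" by (auto simp: cong_def)
    then have "[x = y] (mod m * n)" using assms(1) by (rule coprime_cong_mult_nat)
    then show "x = y" using * by (simp add: cong_def)
  qed
  have "?h ` {..<m * n} \<subseteq> {..<m} \<times> {..<n}" using assms by auto
  moreover have "card (?h ` {..<m * n}) = card ({..<m} \<times> {..<n})"
    using inj by (simp add: card_image)
  ultimately have image: "?h ` {..<m * n} = {..<m} \<times> {..<n}"
    by (intro card_subset_eq) auto
  have "(\<Sum>q<m. u q) * (\<Sum>q<n. v q) = (\<Sum>x\<in>{..<m} \<times> {..<n}. u (fst x) * v (snd x))"
    by (simp add: sum_product sum.cartesian_product case_prod_unfold)
  also have "\<dots> = (\<Sum>q<m * n. u (q mod m) * v (q mod n))"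
    by (subst image[symmetric], subst sum.reindex[OF inj]) simp
  finally show ?thesis by (simp add: u v)
qed

lemma prod_periodic:
  fixes w :: "'a \<Rightarrow> nat \<Rightarrow> real"
  assumes "finite I" "\<And>i q. i \<in> I \<Longrightarrow> w i (q mod r i) = w i q"
  shows "(\<Prod>i\<in>I. w i (q mod (\<Prod>i\<in>I. r i))) = (\<Prod>i\<in>I. w i q)"
proof (rule prod.cong)
  fix i assume i: "i \<in> I"
  then have "r i dvd (\<Prod>i\<in>I. r i)" using assms(1) by (intro dvd_prodI)
  then have "q mod (\<Prod>i\<in>I. r i) mod r i = q mod r i" by (rule mod_mod_cancel)
  then show "w i (q mod (\<Prod>i\<in>I. r i)) = w i q" using assms(2)[OF i] by metis
qed simp

lemma sum_prod_periodic_coprime: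
  fixes w :: "'a \<Rightarrow> nat \<Rightarrow> real"
  assumes "finite I" "\<And>i. i \<in> I \<Longrightarrow> r i > 0"
    and "\<And>i j. i \<in> I \<Longrightarrow> j \<in> I \<Longrightarrow> i \<noteq> j \<Longrightarrow> coprime (r i) (r j)"
    and per: "\<And>i q. i \<in> I \<Longrightarrow> w i (q mod r i) = w i q"
  shows "(\<Sum>q<(\<Prod>i\<in>I. r i). \<Prod>i\<in>I. w i q) = (\<Prod>i\<in>I. \<Sum>q<r i. w i q)"
  using assms
proof (induction I)
  case empty
  then show ?case by simp
next
  case (insert i I)
  have "(\<Sum>q<r i * (\<Prod>i\<in>I. r i). w i q * (\<Prod>i\<in>I. w i q))
      = (\<Sum>q<r i. w i q) * (\<Sum>q<(\<Prod>i\<in>I. r i). \<Prod>i\<in>I. w i q)"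
  proof (rule sum_mult_periodic_coprime)
    show "coprime (r i) (\<Prod>i\<in>I. r i)"
      using insert.hyps insert.prems(2) by (intro prod_coprime_right) auto
    show "(\<Prod>i\<in>I. r i) > 0" using insert.prems(1) by (intro prod_pos) auto
    show "(\<Prod>j\<in>I. w j (q mod (\<Prod>i\<in>I. r i))) = (\<Prod>i\<in>I. w i q)" for q
      using insert.hyps insert.prems(3) by (intro prod_periodic) auto
  qed (use insert.prems in auto)
  then show ?case using insert by simp
qed

lemma sum_periodic_block:
  fixes g :: "nat \<Rightarrow> real"
  assumes per: "\<And>q. g (q mod n) = g q" and "n > 0"
  shows "(\<Sum>q\<in>{a..<a + n}. g q) = (\<Sum>q<n. g q)"
proof (induction a)
  case 0
  then show ?case by (simp add: atLeast0LessThan)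
next
  case (Suc a)
  have "(\<Sum>q\<in>{a..<a + n}. g q) + g (a + n) = (\<Sum>q\<in>{a..<Suc (a + n)}. g q)"
    by simp
  also have "\<dots> = g a + (\<Sum>q\<in>{Suc a..<Suc a + n}. g q)"
    using assms(2) by (subst sum.atLeast_Suc_lessThan) auto
  finally have "(\<Sum>q\<in>{a..<a + n}. g q) + g (a + n) = g a + (\<Sum>q\<in>{Suc a..<Suc a + n}. g q)" .
  moreover have "g (a + n) = g a" using per[of "a + n"] per[of a] by simp
  ultimately show ?case using Suc by simp
qed

section \<open>Integers divisible by one prime of each pair\<close>

text \<open>The product of all primes in the system; divisibility by each of them is periodic with it.\<close>

definition pair_modulus :: "(nat \<times> nat) set \<Rightarrow> nat"
  where "pair_modulus M = (\<Prod>x\<in>M. fst x * snd x)"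

text \<open>
  \<open>hits M q\<close>: the integer \<open>q\<close> is divisible by at least one member of each pair in \<open>M\<close>.
\<close>

definition hits :: "(nat \<times> nat) set \<Rightarrow> nat \<Rightarrow> bool"
  where "hits M q \<longleftrightarrow> (\<forall>x\<in>M. fst x dvd q \<or> snd x dvd q)"

text \<open>
  \<open>avoids M q n\<close>: no larger member of a pair is a common divisor of \<open>q\<close> and \<open>n\<close>. For a system
  of prime pairs, the proportion of such \<open>n\<close> modulo \<open>q\<close> is \<open>avoid_ratio M q\<close>.
\<close>

definition avoids :: "(nat \<times> nat) set \<Rightarrow> nat \<Rightarrow> int \<Rightarrow> bool"
  where "avoids M q n \<longleftrightarrow> (\<forall>x\<in>M. snd x dvd q \<longrightarrow> \<not> int (snd x) dvd n)"

definition avoid_ratio :: "(nat \<times> nat) set \<Rightarrow> nat \<Rightarrow> real"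
  where "avoid_ratio M q = (\<Prod>x | x \<in> M \<and> snd x dvd q. 1 - 1 / real (snd x))"

lemma prime_pairsD:
  assumes "prime_pairs b M" "x \<in> M"
  shows "prime (fst x)" "prime (snd x)" "b < fst x" "fst x < snd x" "snd x \<le> 2 * fst x"
    "[fst x = snd x] (mod b)"
  using assms unfolding prime_pairs_def by blast+

lemma prime_pairs_finite: "prime_pairs b M \<Longrightarrow> finite M"
  by (simp add: prime_pairs_def)

lemma prime_pairs_distinct:
  assumes "prime_pairs b M" "x \<in> M" "y \<in> M" "x \<noteq> y"
  shows "fst x \<noteq> fst y" "fst x \<noteq> snd y" "snd x \<noteq> fst y" "snd x \<noteq> snd y"
  using assms unfolding prime_pairs_def by blast+

lemma prime_pairs_coprime:
  assumes "prime_pairs b M" "x \<in> M" "y \<in> M" "x \<noteq> y"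
  shows "coprime (fst x * snd x) (fst y * snd y)" "coprime (snd x) (snd y)"
  using prime_pairs_distinct[OF assms] prime_pairsD[OF assms(1,2)] prime_pairsD[OF assms(1,3)]
  by (simp_all add: primes_coprime)

lemma prime_pairs_coprime_fst_snd:
  assumes "prime_pairs b M" "x \<in> M"
  shows "coprime (fst x) (snd x)"
  using prime_pairsD[OF assms] by (simp add: primes_coprime)

lemma prime_pairs_pos:
  assumes "prime_pairs b M" "x \<in> M"
  shows "fst x > 0" "snd x > 0"
  using prime_pairsD[OF assms] prime_gt_0_nat by auto

lemma pair_modulus_pos: "prime_pairs b M \<Longrightarrow> pair_modulus M > 0"
  unfolding pair_modulus_def using prime_pairs_pos by (intro prod_pos) auto

lemma sum_of_bool_dvd:
  fixes p :: nat
  assumes "p > 0"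
  shows "(\<Sum>q<p. of_bool (p dvd q) :: real) = 1"
proof -
  have "(\<Sum>q<p. of_bool (p dvd q) :: real) = (\<Sum>q<p. if q = 0 then 1 else 0)"
    using assms by (intro sum.cong) (auto dest: dvd_imp_le)
  then show ?thesis using assms by (simp add: sum.delta)
qed

lemma dvd_mod_mult_iff:
  "p dvd q mod (p * r) \<longleftrightarrow> p dvd (q::nat)" "r dvd q mod (p * r) \<longleftrightarrow> r dvd q"
  by (simp_all add: dvd_mod_iff)

lemma sum_pair:
  assumes "prime_pairs b M" "x \<in> M"
  shows "(\<Sum>q<fst x * snd x. of_bool (fst x dvd q \<or> snd x dvd q)) = real (fst x) + real (snd x) - 1"
    (is ?or)
    and "(\<Sum>q<fst x * snd x. if snd x dvd q then 1 - 1 / real (snd x) else of_bool (fst x dvd q))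
      = real (fst x) * (1 - 1 / real (snd x)) + (real (snd x) - 1)"
    (is ?weighted)
proof -
  let ?r = "fst x" and ?p = "snd x"
  have pos: "?r > 0" "?p > 0" and cop: "coprime ?r ?p"
    using prime_pairs_pos[OF assms] prime_pairs_coprime_fst_snd[OF assms] by auto
  define A :: "nat \<Rightarrow> real" where "A = (\<lambda>q. of_bool (?r dvd q))"
  define B :: "nat \<Rightarrow> real" where "B = (\<lambda>q. of_bool (?p dvd q))"
  have per: "A (q mod ?r) = A q" "B (q mod ?p) = B q" for q
    by (simp_all add: A_def B_def dvd_mod_iff)
  have SA: "(\<Sum>q<?r. A q) = 1" and SB: "(\<Sum>q<?p. B q) = 1"
    unfolding A_def B_def by (rule sum_of_bool_dvd[OF pos(1)], rule sum_of_bool_dvd[OF pos(2)])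
  have SAB: "(\<Sum>q<?r * ?p. u (A q) * v (B q)) = (\<Sum>q<?r. u (A q)) * (\<Sum>q<?p. v (B q))"
    for u v :: "real \<Rightarrow> real"
    using cop pos per by (intro sum_mult_periodic_coprime) auto
  have 1: "(\<Sum>q<?r * ?p. (1 - A q) * (1 - B q)) = (real ?r - 1) * (real ?p - 1)"
    using SAB[of "\<lambda>t. 1 - t" "\<lambda>t. 1 - t"] by (simp add: sum_subtractf SA SB)
  have 2: "(\<Sum>q<?r * ?p. A q * (1 - B q)) = real ?p - 1"
    using SAB[of "\<lambda>t. t" "\<lambda>t. 1 - t"] by (simp add: sum_subtractf SA SB)
  have 3: "(\<Sum>q<?r * ?p. B q) = real ?r"
    using SAB[of "\<lambda>t. 1" "\<lambda>t. t"] by (simp add: SB)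
  have "(\<Sum>q<?r * ?p. of_bool (?r dvd q \<or> ?p dvd q)) = (\<Sum>q<?r * ?p. 1 - (1 - A q) * (1 - B q))"
    by (intro sum.cong) (auto simp: A_def B_def)
  also have "\<dots> = real (?r * ?p) - (real ?r - 1) * (real ?p - 1)"
    using 1 by (simp add: sum_subtractf)
  finally show ?or by (simp add: algebra_simps)
  have "(\<Sum>q<?r * ?p. if ?p dvd q then 1 - 1 / real ?p else of_bool (?r dvd q))
      = (\<Sum>q<?r * ?p. B q * (1 - 1 / real ?p) + A q * (1 - B q))"
    by (intro sum.cong) (auto simp: A_def B_def)
  also have "\<dots> = real ?r * (1 - 1 / real ?p) + (real ?p - 1)"
    using 2 3 by (simp add: sum.distrib flip: sum_distrib_right)
  finally show ?weighted .
qed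

lemma of_bool_hits:
  assumes "finite M"
  shows "(of_bool (hits M q) :: real) = (\<Prod>x\<in>M. of_bool (fst x dvd q \<or> snd x dvd q))"
proof (cases "hits M q")
  case True
  then show ?thesis by (simp add: hits_def)
next
  case False
  then obtain x where "x \<in> M" "\<not> fst x dvd q" "\<not> snd x dvd q" by (auto simp: hits_def)
  then have "(\<Prod>x\<in>M. of_bool (fst x dvd q \<or> snd x dvd q) :: real) = 0"
    using assms by (intro prod_zero) auto
  with False show ?thesis by simp
qed

lemma of_bool_hits_avoid_ratio:
  assumes "finite M"
  shows "of_bool (hits M q) * avoid_ratio M q
    = (\<Prod>x\<in>M. if snd x dvd q then 1 - 1 / real (snd x) else of_bool (fst x dvd q))"
proof -
  have "avoid_ratio M q = (\<Prod>x\<in>M. if snd x dvd q then 1 - 1 / real (snd x) else 1)"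
    unfolding avoid_ratio_def using assms by (rule prod.inter_filter)
  then show ?thesis
    unfolding of_bool_hits[OF assms] by (simp add: prod.distrib[symmetric]) (intro prod.cong, auto)
qed

text \<open>
  Over one period, \<open>hit_count M\<close> is the number of \<open>q\<close> with \<open>hits M q\<close>, and \<open>avoid_count M\<close> is
  the sum of \<open>avoid_ratio M q\<close> over these \<open>q\<close>. Both factor over the pairs.
\<close>

definition hit_count :: "(nat \<times> nat) set \<Rightarrow> real"
  where "hit_count M = (\<Prod>x\<in>M. real (fst x) + real (snd x) - 1)"

definition avoid_count :: "(nat \<times> nat) set \<Rightarrow> real"
  where "avoid_count M = (\<Prod>x\<in>M. real (fst x) * (1 - 1 / real (snd x)) + (real (snd x) - 1))"

lemma hits_mod: "prime_pairs b M \<Longrightarrow> hits M (q mod pair_modulus M) = hits M q"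
proof -
  assume M: "prime_pairs b M"
  have "fst x dvd pair_modulus M" "snd x dvd pair_modulus M" if "x \<in> M" for x
  proof -
    have "fst x * snd x dvd pair_modulus M"
      unfolding pair_modulus_def using that prime_pairs_finite[OF M]
      by (rule dvd_prodI[rotated])
    then show "fst x dvd pair_modulus M" "snd x dvd pair_modulus M"
      using dvd_mult_left dvd_mult_right by blast+
  qed
  then show ?thesis by (auto simp: hits_def dvd_mod_iff)
qed

lemma avoid_ratio_mod:
  assumes "prime_pairs b M"
  shows "avoid_ratio M (q mod pair_modulus M) = avoid_ratio M q"
proof -
  have "snd x dvd pair_modulus M" if "x \<in> M" for x
  proof -
    have "fst x * snd x dvd pair_modulus M"
      unfolding pair_modulus_def using that prime_pairs_finite[OF assms]
      by (rule dvd_prodI[rotated])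
    then show ?thesis using dvd_mult_right by blast
  qed
  then have "{x. x \<in> M \<and> snd x dvd q mod pair_modulus M} = {x. x \<in> M \<and> snd x dvd q}"
    by (auto simp: dvd_mod_iff)
  then show ?thesis by (simp add: avoid_ratio_def)
qed

lemma sum_hits:
  assumes "prime_pairs b M"
  shows "(\<Sum>q<pair_modulus M. of_bool (hits M q)) = hit_count M"
proof -
  have "(\<Sum>q<pair_modulus M. of_bool (hits M q) :: real)
      = (\<Sum>q<(\<Prod>x\<in>M. fst x * snd x). \<Prod>x\<in>M. of_bool (fst x dvd q \<or> snd x dvd q))"
    by (simp only: pair_modulus_def of_bool_hits[OF prime_pairs_finite[OF assms]])
  also have "\<dots> = (\<Prod>x\<in>M. \<Sum>q<fst x * snd x. of_bool (fst x dvd q \<or> snd x dvd q))"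
    using prime_pairs_finite[OF assms] prime_pairs_coprime[OF assms] prime_pairs_pos[OF assms]
    by (intro sum_prod_periodic_coprime) (auto simp: dvd_mod_mult_iff)
  also have "\<dots> = hit_count M"
    unfolding hit_count_def using sum_pair(1)[OF assms] by (intro prod.cong) auto
  finally show ?thesis .
qed

lemma sum_hits_avoid_ratio:
  assumes "prime_pairs b M"
  shows "(\<Sum>q<pair_modulus M. of_bool (hits M q) * avoid_ratio M q) = avoid_count M"
proof -
  let ?w = "\<lambda>x q. if snd x dvd q then 1 - 1 / real (snd x) else of_bool (fst x dvd q)"
  have "(\<Sum>q<pair_modulus M. of_bool (hits M q) * avoid_ratio M q)
      = (\<Sum>q<(\<Prod>x\<in>M. fst x * snd x). \<Prod>x\<in>M. ?w x q)"
    by (simp only: pair_modulus_def of_bool_hits_avoid_ratio[OF prime_pairs_finite[OF assms]])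
  also have "\<dots> = (\<Prod>x\<in>M. \<Sum>q<fst x * snd x. ?w x q)"
    using prime_pairs_finite[OF assms] prime_pairs_coprime[OF assms] prime_pairs_pos[OF assms]
    by (intro sum_prod_periodic_coprime) (auto simp: dvd_mod_mult_iff)
  also have "\<dots> = avoid_count M"
    unfolding avoid_count_def using sum_pair(2)[OF assms] by (intro prod.cong) auto
  finally show ?thesis .
qed

lemma hit_count_ge_1:
  assumes "prime_pairs b M"
  shows "hit_count M \<ge> 1"
  unfolding hit_count_def
proof (rule prod_ge_1)
  fix x assume "x \<in> M"
  then have "fst x \<ge> 1" "snd x \<ge> 1" using prime_pairs_pos[OF assms, of x] by auto
  then show "1 \<le> real (fst x) + real (snd x) - 1" by linarith
qed

text \<open>
  A random \<open>q\<close> with \<open>hits M q\<close> is divisible by the larger prime \<open>p\<close> of a pair with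
  probability \<open>p' / (p + p' - 1) \<ge> 1 / 3\<close>, and then a random \<open>n\<close> is divisible by \<open>p\<close> with
  probability \<open>1 / p\<close>. So each pair saves a factor \<open>1 - 1 / (3 p)\<close>.
\<close>

lemma avoid_count_le:
  assumes "prime_pairs b M"
  shows "avoid_count M \<le> hit_count M * exp (- (\<Sum>x\<in>M. 1 / real (snd x)) / 3)"
proof -
  have "avoid_count M \<le> (\<Prod>x\<in>M. (real (fst x) + real (snd x) - 1) * exp (- (1 / real (snd x)) / 3))"
    unfolding avoid_count_def
  proof (intro prod_mono conjI)
    fix x assume x: "x \<in> M"
    let ?r = "real (fst x)" and ?p = "real (snd x)"
    have *: "?r \<ge> 1" "?p \<ge> 1" "?r < ?p" "?p \<le> 2 * ?r"
      using prime_pairsD[OF assms x] prime_pairs_pos[OF assms x] by auto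
    show "0 \<le> ?r * (1 - 1 / ?p) + (?p - 1)" using * by (intro add_nonneg_nonneg) auto
    have "(?r + ?p - 1) / (3 * ?p) \<le> (3 * ?r) / (3 * ?p)"
      using * by (intro divide_right_mono) auto
    then have "(?r + ?p - 1) - ?r / ?p \<le> (?r + ?p - 1) - (?r + ?p - 1) / (3 * ?p)" by simp
    moreover have "?r * (1 - 1 / ?p) + (?p - 1) = (?r + ?p - 1) - ?r / ?p"
      by (simp add: right_diff_distrib)
    moreover have "(?r + ?p - 1) * (1 - 1 / ?p / 3) = (?r + ?p - 1) - (?r + ?p - 1) / (3 * ?p)"
      by (simp add: right_diff_distrib mult.commute)
    ultimately have "?r * (1 - 1 / ?p) + (?p - 1) \<le> (?r + ?p - 1) * (1 - 1 / ?p / 3)" by simp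
    also have "\<dots> \<le> (?r + ?p - 1) * exp (- (1 / ?p) / 3)"
      using * exp_ge_add_one_self[of "- (1 / ?p) / 3"] by (intro mult_left_mono) auto
    finally show "?r * (1 - 1 / ?p) + (?p - 1) \<le> (?r + ?p - 1) * exp (- (1 / ?p) / 3)" .
  qed
  also have "\<dots> = hit_count M * exp (\<Sum>x\<in>M. - (1 / real (snd x)) / 3)"
    using prime_pairs_finite[OF assms] by (simp add: prod.distrib hit_count_def exp_sum)
  also have "(\<Sum>x\<in>M. - (1 / real (snd x)) / 3) = - (\<Sum>x\<in>M. 1 / real (snd x)) / 3"
    by (simp add: sum_negf sum_divide_distrib)
  finally show ?thesis .
qed

lemma hit_count_le:
  assumes "prime_pairs b M" "M \<noteq> {}" "b \<ge> 2"
  shows "hit_count M / real (pair_modulus M) \<le> 2 / real b"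
proof -
  define h where "h = (\<lambda>x. (real (fst x) + real (snd x) - 1) / (real (fst x) * real (snd x)))"
  have h: "0 \<le> h x" "h x \<le> 2 / real b" if "x \<in> M" for x
  proof -
    let ?r = "real (fst x)" and ?p = "real (snd x)"
    have *: "?r \<ge> 1" "?p \<ge> 1" "real b < ?r" "?r < ?p"
      using prime_pairsD[OF assms(1) that] prime_pairs_pos[OF assms(1) that] by auto
    show "0 \<le> h x" unfolding h_def using * by auto
    have "h x \<le> (?r + ?p) / (?r * ?p)" unfolding h_def using * by (intro divide_right_mono) auto
    also have "\<dots> = 1 / ?p + 1 / ?r" using * by (simp add: field_simps)
    also have "\<dots> \<le> 1 / real b + 1 / real b"
      using * assms(3) by (intro add_mono frac_le) auto
    finally show "h x \<le> 2 / real b" by simp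
  qed
  obtain x where x: "x \<in> M" using assms(2) by auto
  have "hit_count M / real (pair_modulus M) = (\<Prod>x\<in>M. h x)"
    by (simp add: hit_count_def pair_modulus_def h_def prod_dividef)
  also have "\<dots> = h x * (\<Prod>x\<in>M - {x}. h x)"
    using x prime_pairs_finite[OF assms(1)] by (intro prod.remove)
  also have "\<dots> \<le> 2 / real b * 1"
  proof (intro mult_mono prod_le_1 prod_nonneg)
    fix y assume "y \<in> M - {x}"
    then have "h y \<le> 2 / real b" using h by auto
    also have "\<dots> \<le> 1" using assms(3) by simp
    finally show "0 \<le> h y \<and> h y \<le> 1" using h \<open>y \<in> M - {x}\<close> by auto
  qed (use h x in auto)
  finally show ?thesis by simp
qed

lemma pair_modulus_ge:
  assumes "prime_pairs b M" "M \<noteq> {}"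
  shows "b \<le> pair_modulus M"
proof -
  obtain x where x: "x \<in> M" using assms(2) by auto
  have "b \<le> fst x * snd x" using prime_pairsD(3)[OF assms(1) x] prime_pairs_pos[OF assms(1) x]
    by (metis Suc_leI le_trans less_imp_le mult.right_neutral mult_le_mono2 One_nat_def)
  also have "\<dots> \<le> pair_modulus M"
    unfolding pair_modulus_def using x prime_pairs_finite[OF assms(1)]
      pair_modulus_pos[OF assms(1)] by (intro dvd_imp_le dvd_prodI) (auto simp: pair_modulus_def)
  finally show ?thesis .
qed

lemma prod_dvd_of_coprime:
  fixes r :: "'a \<Rightarrow> nat"
  assumes "finite I" "\<And>i. i \<in> I \<Longrightarrow> r i dvd q"
    and "\<And>i j. i \<in> I \<Longrightarrow> j \<in> I \<Longrightarrow> i \<noteq> j \<Longrightarrow> coprime (r i) (r j)"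
  shows "(\<Prod>i\<in>I. r i) dvd q"
  using assms
proof (induction I)
  case (insert i I)
  have "coprime (r i) (\<Prod>i\<in>I. r i)"
    using insert.hyps insert.prems(2) by (intro prod_coprime_right) auto
  moreover have "r i dvd q" "(\<Prod>i\<in>I. r i) dvd q"
    using insert by auto
  ultimately show ?case using insert.hyps by (simp add: divides_mult)
qed simp

text \<open>
  Along \<open>a + c b\<close> the conditions \<open>p dvd n\<close> are independent with probability \<open>1 / p\<close>, since the
  primes \<open>p > b\<close> do not divide \<open>b\<close>. No relation between \<open>a\<close> and \<open>b\<close> is required. Two
  periods of \<open>c\<close> are counted, which leaves room for all fractions relevant to the unit interval.
\<close>

lemma sum_avoids_le:
  assumes M: "prime_pairs b M" and "q > 0" "b > 0"
  shows "(\<Sum>c<2 * q. of_bool (avoids M q (a + int c * int b))) \<le> 2 * real q * avoid_ratio M q"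
proof -
  define I where "I = {x \<in> M. snd x dvd q}"
  define R where "R = (\<Prod>x\<in>I. snd x)"
  define w :: "nat \<times> nat \<Rightarrow> nat \<Rightarrow> real"
    where "w = (\<lambda>x c. of_bool (\<not> int (snd x) dvd a + int c * int b))"
  have fin: "finite I" using prime_pairs_finite[OF M] by (simp add: I_def)
  have pos: "snd x > 0" if "x \<in> I" for x using that prime_pairs_pos[OF M] by (simp add: I_def)
  have Rpos: "R > 0" unfolding R_def using pos by (intro prod_pos) auto
  have "R dvd q"
    unfolding R_def using fin prime_pairs_coprime(2)[OF M]
    by (intro prod_dvd_of_coprime) (auto simp: I_def)
  then obtain t where t: "q = R * t" by auto
  have per: "w x (c mod snd x) = w x c" for x c
  proof -
    have "[int (c mod snd x) = int c] (mod int (snd x))" by (simp add: cong_def zmod_int)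
    then have "[a + int (c mod snd x) * int b = a + int c * int b] (mod int (snd x))"
      by (intro cong_add cong_mult) auto
    then show ?thesis by (simp add: w_def cong_dvd_iff)
  qed
  have one: "(\<Sum>c<snd x. w x c) \<le> real (snd x) * (1 - 1 / real (snd x))" if x: "x \<in> I" for x
  proof -
    let ?p = "snd x"
    have p: "prime ?p" "b < ?p" using prime_pairsD[OF M, of x] x by (auto simp: I_def)
    have "\<not> ?p dvd b" using p(2) assms(3) by (auto dest: dvd_imp_le)
    then have "coprime b ?p" using p(1) prime_imp_coprime[of ?p b] by (simp add: coprime_commute)
    then obtain z where z: "[int b * z = 1] (mod int ?p)"
      using cong_solve_coprime_int[of "int b" "int ?p"] by auto
    \<comment> \<open>the residue modulo \<open>p\<close> at which \<open>a + c b\<close> is divisible by \<open>p\<close>\<close>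
    define c where "c = nat ((- a * z) mod int ?p)"
    have c: "c < ?p" using pos[OF x] by (simp add: c_def nat_less_iff)
    have "[int c = - a * z] (mod int ?p)" using pos[OF x] by (simp add: c_def cong_def)
    then have "[a + int c * int b = a + (- a * z) * int b] (mod int ?p)"
      by (intro cong_add cong_mult) auto
    also have "a + (- a * z) * int b = a - a * (int b * z)" by (simp add: algebra_simps)
    also have "[a - a * (int b * z) = a - a * 1] (mod int ?p)"
      using z by (intro cong_diff cong_mult) auto
    finally have "int ?p dvd a + int c * int b" by (simp add: cong_0_iff)
    then have "w x c = 0" by (simp add: w_def)
    then have "(\<Sum>c<?p. w x c) = (\<Sum>c\<in>{..<?p} - {c}. w x c)"
      using c by (subst sum.remove[of _ c]) auto
    also have "\<dots> \<le> (\<Sum>c\<in>{..<?p} - {c}. 1)" by (intro sum_mono) (simp add: w_def)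
    also have "\<dots> = real ?p - 1" using c by (simp add: of_nat_diff)
    also have "\<dots> = real ?p * (1 - 1 / real ?p)" using pos[OF x] by (simp add: field_simps)
    finally show ?thesis .
  qed
  let ?W = "\<lambda>c. \<Prod>x\<in>I. w x c"
  have avoid: "of_bool (avoids M q (a + int c * int b)) = ?W c" for c
  proof (cases "avoids M q (a + int c * int b)")
    case True
    then show ?thesis by (simp add: avoids_def I_def w_def)
  next
    case False
    then obtain x where "x \<in> M" "snd x dvd q" "int (snd x) dvd a + int c * int b"
      unfolding avoids_def by blast
    then have "x \<in> I" "w x c = 0" by (simp_all add: I_def w_def)
    then have "?W c = 0" using fin by (intro prod_zero) auto
    with False show ?thesis by simp
  qed
  have blocks: "(\<Sum>c<R * s. ?W c) = real s * (\<Sum>c<R. ?W c)" for s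
  proof (induction s)
    case (Suc s)
    have "{..<R * Suc s} = {..<R * s} \<union> {R * s..<R * s + R}" by auto
    then have "(\<Sum>c<R * Suc s. ?W c) = (\<Sum>c\<in>{..<R * s} \<union> {R * s..<R * s + R}. ?W c)"
      by (rule arg_cong)
    also have "\<dots> = (\<Sum>c<R * s. ?W c) + (\<Sum>c\<in>{R * s..<R * s + R}. ?W c)"
      by (rule sum.union_disjoint) auto
    finally have "(\<Sum>c<R * Suc s. ?W c)
        = (\<Sum>c<R * s. ?W c) + (\<Sum>c\<in>{R * s..<R * s + R}. ?W c)" .
    also have "(\<Sum>c\<in>{R * s..<R * s + R}. ?W c) = (\<Sum>c<R. ?W c)"
      using prod_periodic[of I w snd] fin per Rpos
      by (intro sum_periodic_block) (auto simp: R_def)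
    finally show ?case using Suc by (simp add: algebra_simps)
  qed simp
  have "(\<Sum>c<R. ?W c) = (\<Prod>x\<in>I. \<Sum>c<snd x. w x c)"
    unfolding R_def using fin pos per prime_pairs_coprime(2)[OF M]
    by (intro sum_prod_periodic_coprime) (auto simp: I_def)
  also have "\<dots> \<le> (\<Prod>x\<in>I. real (snd x) * (1 - 1 / real (snd x)))"
    using one by (intro prod_mono conjI sum_nonneg) (auto simp: w_def)
  also have "\<dots> = real R * avoid_ratio M q"
    by (simp add: prod.distrib R_def avoid_ratio_def I_def)
  finally have "real (2 * t) * (\<Sum>c<R. ?W c) \<le> real (2 * t) * (real R * avoid_ratio M q)"
    by (intro mult_left_mono) auto
  moreover have "2 * q = R * (2 * t)" by (simp add: t)
  ultimately show ?thesis
    unfolding avoid by (simp only: blocks) (simp add: t mult_ac)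
qed

section \<open>Covering the approximable points\<close>

text \<open>
  The exchange step. If \<open>p\<close> divides both \<open>q\<close> and the numerator of \<open>(a + c b) / (b q)\<close>, then
  cancelling \<open>p\<close> and expanding by \<open>p'\<close> writes the same number with denominator
  \<open>b (q / p) p'\<close>. The numerator stays in the class of \<open>a\<close> modulo \<open>b\<close> because \<open>p' \<equiv> p\<close>.
\<close>

lemma exchange_prime:
  assumes M: "prime_pairs b M" and x: "x \<in> M" and "b > 0" "q > 0"
    and hits: "hits M q" and dvd: "snd x dvd q" "int (snd x) dvd a + c * int b"
  obtains q' c' where "q' < q" "q \<le> 2 * q'" "hits M q'"
    "real_of_int (a + c' * int b) / (real b * real q') = real_of_int (a + c * int b) / (real b * real q)"
proof -
  let ?r = "fst x" and ?p = "snd x"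
  note pp = prime_pairsD[OF M x] and pos = prime_pairs_pos[OF M x]
  obtain d where d: "q = ?p * d" using dvd(1) by auto
  obtain n where n: "a + c * int b = int ?p * n" using dvd(2) by auto
  have dpos: "d > 0" using d assms(4) by (cases d) auto
  have "[int ?r = int ?p] (mod int b)" using pp(6) by (simp add: cong_int_iff)
  then obtain e where e: "int ?r - int ?p = int b * e" by (auto simp: cong_iff_dvd_diff)
  define q' where "q' = ?r * d"
  define c' where "c' = c + n * e"
  have num: "a + c' * int b = n * int ?r"
  proof -
    have "int ?r = int ?p + int b * e" using e by simp
    then have "n * int ?r = int ?p * n + n * e * int b" by (simp add: algebra_simps)
    then show ?thesis using n by (simp add: c'_def algebra_simps)
  qed
  have "hits M q'"
    unfolding hits_def
  proof
    fix y assume y: "y \<in> M"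
    show "fst y dvd q' \<or> snd y dvd q'"
    proof (cases "y = x")
      case False
      have *: "z dvd q'" if "prime z" "z \<noteq> ?p" "z dvd q" for z
      proof -
        have "coprime z ?p" using that pp(2) by (intro primes_coprime)
        then have "z dvd d" using that(3) d by (simp add: coprime_dvd_mult_right_iff)
        then show ?thesis by (simp add: q'_def)
      qed
      have "fst y dvd q \<or> snd y dvd q" using hits y by (auto simp: hits_def)
      then show ?thesis
        using * prime_pairs_distinct[OF M y x False] prime_pairsD[OF M y] by auto
    qed (simp add: q'_def)
  qed
  moreover have "q' < q" using pp(4) dpos by (simp add: q'_def d)
  moreover have "q \<le> 2 * q'"
    using mult_le_mono1[OF pp(5), of d] by (simp add: q'_def d mult_ac)
  moreover have "real_of_int (a + c' * int b) / (real b * real q')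
      = real_of_int (a + c * int b) / (real b * real q)"
    unfolding num n using pos dpos assms(3) by (simp add: q'_def d)
  ultimately show ?thesis using that by blast
qed

text \<open>
  Exchanges decrease \<open>q\<close> and only enlarge the interval around the fraction. They stay above
  \<open>N\<close> as long as \<open>q > 2 N\<close>, because \<open>p \<le> 2 p'\<close>.
\<close>

lemma exchange_descent:
  fixes f :: "nat \<Rightarrow> real"
  assumes M: "prime_pairs b M" and "b > 0"
    and mono: "\<And>q r. 1 \<le> q \<Longrightarrow> q \<le> r \<Longrightarrow> f r \<le> f q"
    and nonneg: "\<And>q. 1 \<le> q \<Longrightarrow> 0 \<le> f q"
    and q: "N < q" "q \<le> Y" "hits M q"
    and approx: "\<bar>\<alpha> - real_of_int (a + c * int b) / (real b * real q)\<bar> < 2 * f q / real q"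
  shows "\<exists>q' c'. N < q' \<and> q' \<le> Y \<and> hits M q' \<and> (q' \<le> 2 * N \<or> avoids M q' (a + c' * int b)) \<and>
      \<bar>\<alpha> - real_of_int (a + c' * int b) / (real b * real q')\<bar> < 2 * f q' / real q'"
  using q approx
proof (induction q arbitrary: c rule: less_induct)
  case (less q)
  show ?case
  proof (cases "q \<le> 2 * N \<or> avoids M q (a + c * int b)")
    case True
    then show ?thesis using less.prems by blast
  next
    case False
    then obtain x where x: "x \<in> M" "snd x dvd q" "int (snd x) dvd a + c * int b"
      by (auto simp: avoids_def)
    have "q > 0" using less.prems by simp
    then obtain q' c' where q': "q' < q" "q \<le> 2 * q'" "hits M q'"
      and eq: "real_of_int (a + c' * int b) / (real b * real q')
        = real_of_int (a + c * int b) / (real b * real q)"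
      using exchange_prime[OF M x(1) assms(2) _ less.prems(3) x(2,3)] by blast
    have "N < q'" using False q' by simp
    have "f q / real q \<le> f q' / real q'"
      using q' \<open>N < q'\<close> mono[of q' q] nonneg[of q'] by (intro frac_le) auto
    then have "\<bar>\<alpha> - real_of_int (a + c' * int b) / (real b * real q')\<bar> < 2 * f q' / real q'"
      using less.prems(4) unfolding eq by simp
    then show ?thesis using less.IH[of q'] q' \<open>N < q'\<close> less.prems by simp
  qed
qed

lemma sum_antimono_periodic:
  fixes f g :: "nat \<Rightarrow> real"
  assumes "N > 0" "1 \<le> k" "k \<le> m"
    and mono: "\<And>q r. 1 \<le> q \<Longrightarrow> q \<le> r \<Longrightarrow> f r \<le> f q"
    and g: "\<And>q. g (q mod N) = g q" "\<And>q. g q \<ge> 0"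
  shows "(\<Sum>q\<in>{N * k<..N * m}. f q * g q) \<le> (\<Sum>q<N. g q) * (\<Sum>j=k..<m. f (N * j))" (is "?S m \<le> ?U m")
    and "(\<Sum>q\<in>{N * k<..N * m}. f q * g q) \<ge> (\<Sum>q<N. g q) * (\<Sum>j=Suc k..m. f (N * j))" (is "_ \<ge> ?L m")
proof -
  have "?S m \<le> ?U m \<and> ?S m \<ge> ?L m"
    using assms(3)
  proof (induction m rule: dec_induct)
    case base
    then show ?case by simp
  next
    case (step m)
    have G: "(\<Sum>q\<in>{N * m<..N * Suc m}. g q) = (\<Sum>q<N. g q)"
    proof -
      have "{N * m<..N * Suc m} = {Suc (N * m)..<Suc (N * m) + N}" by auto
      then show ?thesis using sum_periodic_block[of g N "Suc (N * m)"] g(1) assms(1) by simp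
    qed
    have "{N * k<..N * Suc m} = {N * k<..N * m} \<union> {N * m<..N * Suc m}"
      using step(1) by (intro ivl_disj_un_two(6)[symmetric]) auto
    then have "?S (Suc m) = (\<Sum>q\<in>{N * k<..N * m} \<union> {N * m<..N * Suc m}. f q * g q)"
      by (rule arg_cong)
    also have "\<dots> = ?S m + (\<Sum>q\<in>{N * m<..N * Suc m}. f q * g q)"
      by (rule sum.union_disjoint) auto
    finally have split: "?S (Suc m) = ?S m + (\<Sum>q\<in>{N * m<..N * Suc m}. f q * g q)" .
    have pos: "1 \<le> N * m" using step(1) assms(1,2) by simp
    have "(\<Sum>q\<in>{N * m<..N * Suc m}. f q * g q) \<le> (\<Sum>q\<in>{N * m<..N * Suc m}. f (N * m) * g q)"
      using pos g by (intro sum_mono mult_right_mono mono) auto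
    moreover have "(\<Sum>q\<in>{N * m<..N * Suc m}. f q * g q)
        \<ge> (\<Sum>q\<in>{N * m<..N * Suc m}. f (N * Suc m) * g q)"
      using pos g by (intro sum_mono mult_right_mono mono) auto
    ultimately have 1: "(\<Sum>q\<in>{N * m<..N * Suc m}. f q * g q) \<le> (\<Sum>q<N. g q) * f (N * m)"
      "(\<Sum>q\<in>{N * m<..N * Suc m}. f q * g q) \<ge> (\<Sum>q<N. g q) * f (N * Suc m)"
      unfolding sum_distrib_left[symmetric] G by (simp_all add: mult.commute)
    have "?U (Suc m) = ?U m + (\<Sum>q<N. g q) * f (N * m)"
      using step(1) by (simp add: distrib_left)
    moreover have "?L (Suc m) = ?L m + (\<Sum>q<N. g q) * f (N * Suc m)"
      using step(1) by (simp add: distrib_left)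
    ultimately show ?case using 1 split step.IH by linarith
  qed
  then show "?S m \<le> ?U m" "?S m \<ge> ?L m" by auto
qed

text \<open>
  Only the fractions that admit no exchange have to be covered. In the first period
  \<open>(N, 2 N]\<close>, where an exchange could leave the range, all of them are counted; this is
  affordable because the density of \<open>hits M\<close> is small.
\<close>

lemma ex_small_cover:
  fixes f :: "nat \<Rightarrow> real" and a :: int
  assumes M: "prime_pairs b M" "M \<noteq> {}" and b: "b \<ge> 5" and m: "m \<ge> 2"
    and mono: "\<And>q r. 1 \<le> q \<Longrightarrow> q \<le> r \<Longrightarrow> f r \<le> f q"
    and nonneg: "\<And>q. 1 \<le> q \<Longrightarrow> 0 \<le> f q"
    and f_le: "\<And>q. 1 \<le> q \<Longrightarrow> f q \<le> 1 / real q"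
  defines "N \<equiv> pair_modulus M"
  shows "\<exists>C. C \<in> lmeasurable \<and>
    (\<forall>\<alpha>\<in>{0..1}. \<forall>q c. N < q \<longrightarrow> q \<le> N * m \<longrightarrow> hits M q \<longrightarrow>
        \<bar>real q * \<alpha> - real_of_int a / real b - real_of_int c\<bar> < 2 * f q \<longrightarrow> \<alpha> \<in> C) \<and>
    measure lebesgue C \<le> 8 * (hit_count M / real N + avoid_count M * (\<Sum>j=2..m. f (N * j)))"
proof -
  define S where "S = {q. N < q \<and> q \<le> N * m \<and> hits M q}"
  \<comment> \<open>For \<open>\<alpha>\<close> in the unit interval all relevant \<open>c\<close> lie between \<open>c0\<close> and \<open>c0 + q + 5\<close>, hence
    within two periods modulo \<open>q\<close> because \<open>q > N \<ge> 5\<close>.\<close>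
  define c0 where "c0 = \<lfloor>- real_of_int a / real b\<rfloor> - 2"
  define a' where "a' = a + c0 * int b"
  define ctr where "ctr = (\<lambda>q (c::int). real_of_int (a + c * int b) / (real b * real q))"
  define T where "T = (\<lambda>q. {c. c < 2 * q \<and> (q \<le> 2 * N \<or> avoids M q (a' + int c * int b))})"
  define C where "C = (\<Union>q\<in>S. \<Union>c\<in>T q. ball (ctr q (c0 + int c)) (2 * f q / real q))"
  have N5: "N \<ge> 5" using pair_modulus_ge[OF M] b by (simp add: N_def)
  have finS: "finite S" by (rule finite_subset[of _ "{..N * m}"]) (auto simp: S_def)
  have finT: "finite (T q)" for q by (rule finite_subset[of _ "{..<2 * q}"]) (auto simp: T_def)
  have ctr: "real q * \<alpha> - real_of_int a / real b - real_of_int c = real q * (\<alpha> - ctr q c)"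
    if "q > 0" for q \<alpha> c
    using that b by (simp add: ctr_def field_simps)
  have close: "\<bar>real q * \<alpha> - real_of_int a / real b - real_of_int c\<bar> < 2 * f q
      \<longleftrightarrow> \<bar>\<alpha> - ctr q c\<bar> < 2 * f q / real q" if "q > 0" for q \<alpha> c
    unfolding ctr[OF that] using that by (simp add: abs_mult pos_less_divide_eq mult.commute)
  have cover: "\<alpha> \<in> C"
    if \<alpha>: "\<alpha> \<in> {0..1}" and q: "N < q" "q \<le> N * m" "hits M q"
      and approx: "\<bar>real q * \<alpha> - real_of_int a / real b - real_of_int c\<bar> < 2 * f q"
    for \<alpha> q c
  proof -
    have approx_q: "\<bar>\<alpha> - real_of_int (a + c * int b) / (real b * real q)\<bar> < 2 * f q / real q"
      using approx close[of q \<alpha> c] q by (simp add: ctr_def)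
    have "b > 0" using b by simp
    then obtain q' c' where q': "N < q'" "q' \<le> N * m" "hits M q'"
        "q' \<le> 2 * N \<or> avoids M q' (a + c' * int b)"
      and approx': "\<bar>\<alpha> - ctr q' c'\<bar> < 2 * f q' / real q'"
      using exchange_descent[where f = f, OF M(1) _ mono nonneg q approx_q] unfolding ctr_def
      by blast
    have "f q' \<le> 1"
      using f_le[of q'] inverse_of_nat_le_1[of q'] q' by linarith
    then have *: "\<bar>real q' * \<alpha> - real_of_int a / real b - real_of_int c'\<bar> < 2"
      using approx' close[of q' \<alpha> c'] q' by simp
    have "0 \<le> real q' * \<alpha>" "real q' * \<alpha> \<le> real q'"
      using \<alpha> by (auto simp: mult_left_le)
    moreover have "real_of_int c0 + 2 \<le> - real_of_int a / real b"
      "- real_of_int a / real b < real_of_int c0 + 3"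
      unfolding c0_def by linarith+
    ultimately have "real_of_int c0 < real_of_int c'" "real_of_int c' < real_of_int c0 + real q' + 5"
      using * by linarith+
    then have c': "c0 < c'" "c' < c0 + int q' + 5" by linarith+
    define n where "n = nat (c' - c0)"
    have n: "c' = c0 + int n" using c' by (simp add: n_def)
    have "n < 2 * q'" using c' q'(1) N5 n by linarith
    moreover have "a' + int n * int b = a + c' * int b" by (simp add: a'_def n algebra_simps)
    ultimately have "n \<in> T q'" using q'(4) by (simp add: T_def)
    moreover have "\<alpha> \<in> ball (ctr q' (c0 + int n)) (2 * f q' / real q')"
      using approx' by (simp add: n dist_real_def abs_minus_commute)
    moreover have "q' \<in> S" using q' by (simp add: S_def)
    ultimately show ?thesis unfolding C_def by blast
  qed
  have meas: "C \<in> lmeasurable"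
    unfolding C_def using finS finT
    by (intro fmeasurable.finite_UN) auto
  let ?g = "\<lambda>q. of_bool (hits M q) :: real"
  let ?h = "\<lambda>q. of_bool (hits M q) * avoid_ratio M q"
  have "measure lebesgue C \<le> (\<Sum>q\<in>S. measure lebesgue (\<Union>c\<in>T q. ball (ctr q (c0 + int c)) (2 * f q / real q)))"
    unfolding C_def using finS finT
    by (intro measure_UNION_le) (auto intro!: sets.finite_UN)
  also have "\<dots> \<le> (\<Sum>q\<in>S. \<Sum>c\<in>T q. measure lebesgue (ball (ctr q (c0 + int c)) (2 * f q / real q)))"
    using finT by (intro sum_mono measure_UNION_le) auto
  also have "\<dots> = (\<Sum>q\<in>S. real (card (T q)) * (4 * f q / real q))"
  proof (intro sum.cong refl)
    fix q assume "q \<in> S"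
    then have "f q \<ge> 0" using nonneg by (simp add: S_def)
    then show "(\<Sum>c\<in>T q. measure lebesgue (ball (ctr q (c0 + int c)) (2 * f q / real q)))
        = real (card (T q)) * (4 * f q / real q)"
      by (simp add: ball_eq_greaterThanLessThan)
  qed
  also have "\<dots> \<le> (\<Sum>q\<in>S. 8 * (f q * (if q \<le> 2 * N then 1 else avoid_ratio M q)))"
  proof (rule sum_mono)
    fix q assume q: "q \<in> S"
    then have q0: "q > 0" "f q \<ge> 0" using nonneg by (simp_all add: S_def)
    have "real (card (T q)) \<le> 2 * real q * (if q \<le> 2 * N then 1 else avoid_ratio M q)"
    proof (cases "q \<le> 2 * N")
      case True
      then have "T q = {..<2 * q}" by (auto simp: T_def)
      then show ?thesis using True by simp
    next
      case False
      then have "T q = {..<2 * q} \<inter> {c. avoids M q (a' + int c * int b)}" by (auto simp: T_def)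
      then have "real (card (T q)) = (\<Sum>c<2 * q. of_bool (avoids M q (a' + int c * int b)))"
        by simp
      then show ?thesis using sum_avoids_le[OF M(1) q0(1), of a'] b False by simp
    qed
    then have "real (card (T q)) * (4 * f q / real q)
        \<le> 2 * real q * (if q \<le> 2 * N then 1 else avoid_ratio M q) * (4 * f q / real q)"
      using q0 by (intro mult_right_mono) auto
    also have "\<dots> = 8 * (f q * (if q \<le> 2 * N then 1 else avoid_ratio M q))"
      using q0 by (simp add: field_simps)
    finally show "real (card (T q)) * (4 * f q / real q)
        \<le> 8 * (f q * (if q \<le> 2 * N then 1 else avoid_ratio M q))" .
  qed
  also have "\<dots> = 8 * (\<Sum>q\<in>{N * 1<..N * m}. f q * (if q \<le> 2 * N then ?g q else ?h q))"
  proof -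
    have "S = {q \<in> {N * 1<..N * m}. hits M q}" by (auto simp: S_def)
    then have "(\<Sum>q\<in>S. f q * (if q \<le> 2 * N then 1 else avoid_ratio M q))
        = (\<Sum>q\<in>{N * 1<..N * m}. if hits M q then f q * (if q \<le> 2 * N then 1 else avoid_ratio M q) else 0)"
      by (simp only: sum.inter_filter finite_greaterThanAtMost)
    also have "\<dots> = (\<Sum>q\<in>{N * 1<..N * m}. f q * (if q \<le> 2 * N then ?g q else ?h q))"
      by (intro sum.cong) auto
    finally show ?thesis by (simp only: sum_distrib_left[symmetric])
  qed
  also have "(\<Sum>q\<in>{N * 1<..N * m}. f q * (if q \<le> 2 * N then ?g q else ?h q))
     = (\<Sum>q\<in>{N * 1<..N * 2}. f q * ?g q) + (\<Sum>q\<in>{N * 2<..N * m}. f q * ?h q)"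
  proof -
    have "{N * 1<..N * m} = {N * 1<..N * 2} \<union> {N * 2<..N * m}"
      using m by (intro ivl_disj_un_two(6)[symmetric]) auto
    then have "(\<Sum>q\<in>{N * 1<..N * m}. f q * (if q \<le> 2 * N then ?g q else ?h q))
      = (\<Sum>q\<in>{N * 1<..N * 2} \<union> {N * 2<..N * m}. f q * (if q \<le> 2 * N then ?g q else ?h q))"
      by (rule arg_cong)
    also have "\<dots> = (\<Sum>q\<in>{N * 1<..N * 2}. f q * (if q \<le> 2 * N then ?g q else ?h q))
        + (\<Sum>q\<in>{N * 2<..N * m}. f q * (if q \<le> 2 * N then ?g q else ?h q))"
      by (rule sum.union_disjoint) auto
    also have "\<dots> = (\<Sum>q\<in>{N * 1<..N * 2}. f q * ?g q) + (\<Sum>q\<in>{N * 2<..N * m}. f q * ?h q)"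
      by (intro arg_cong2[where f = "(+)"] sum.cong) auto
    finally show ?thesis .
  qed
  also have "(\<Sum>q\<in>{N * 1<..N * 2}. f q * ?g q) \<le> hit_count M / real N"
  proof -
    have "(\<Sum>q\<in>{N * 1<..N * 2}. f q * ?g q) \<le> (\<Sum>q<N. ?g q) * (\<Sum>j=1..<2. f (N * j))"
      using N5 hits_mod[OF M(1)] by (intro sum_antimono_periodic(1) mono) (auto simp: N_def)
    also have "\<dots> = hit_count M * f N"
      unfolding N_def sum_hits[OF M(1)] by (simp add: numeral_2_eq_2)
    also have "\<dots> \<le> hit_count M * (1 / real N)"
      using f_le[of N] N5 hit_count_ge_1[OF M(1)] by (intro mult_left_mono) auto
    finally show ?thesis by simp
  qed
  also have "(\<Sum>q\<in>{N * 2<..N * m}. f q * ?h q) \<le> avoid_count M * (\<Sum>j=2..m. f (N * j))"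
  proof -
    have nn: "avoid_ratio M q \<ge> 0" for q
      unfolding avoid_ratio_def by (intro prod_nonneg) (simp add: inverse_of_nat_le_1)
    have "(\<Sum>q\<in>{N * 2<..N * m}. f q * ?h q) \<le> (\<Sum>q<N. ?h q) * (\<Sum>j=2..<m. f (N * j))"
      using N5 hits_mod[OF M(1)] avoid_ratio_mod[OF M(1)] m nn
      by (intro sum_antimono_periodic(1) mono) (auto simp: N_def)
    also have "\<dots> = avoid_count M * (\<Sum>j=2..<m. f (N * j))"
      unfolding N_def sum_hits_avoid_ratio[OF M(1)] ..
    also have "\<dots> \<le> avoid_count M * (\<Sum>j=2..m. f (N * j))"
    proof (rule mult_left_mono)
      show "(\<Sum>j=2..<m. f (N * j)) \<le> (\<Sum>j=2..m. f (N * j))"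
        using N5 by (intro sum_mono2 nonneg) auto
      have "0 \<le> (\<Sum>q<N. ?h q)" using nn by (intro sum_nonneg) auto
      then show "0 \<le> avoid_count M" unfolding N_def sum_hits_avoid_ratio[OF M(1)] .
    qed
    finally show ?thesis .
  qed
  finally have "measure lebesgue C
      \<le> 8 * (hit_count M / real N + avoid_count M * (\<Sum>j=2..m. f (N * j)))" by simp
  with meas cover show ?thesis by (intro exI[of _ C]) blast
qed

section \<open>Finite blocks with large sum and small cover\<close>

lemma ln_pair_modulus_le:
  assumes "prime_pairs b M" "M \<subseteq> {1..y} \<times> {1..y}" "y \<ge> 1"
  shows "ln (real (pair_modulus M)) \<le> 2 * real y ^ 2 * ln (real y)"
proof -
  have "pair_modulus M \<le> (\<Prod>x\<in>M. y * y)"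
    unfolding pair_modulus_def using assms(2) by (intro prod_mono) (auto intro!: mult_le_mono)
  also have "\<dots> = (y * y) ^ card M" by simp
  also have "\<dots> \<le> (y * y) ^ (y * y)"
  proof (rule power_increasing)
    have "card M \<le> card ({1..y} \<times> {1..y})" using assms(2) by (intro card_mono) auto
    then show "card M \<le> y * y" by simp
  qed (use assms(3) in auto)
  finally have "real (pair_modulus M) \<le> real ((y * y) ^ (y * y))" by (simp only: of_nat_le_iff)
  then have "ln (real (pair_modulus M)) \<le> ln (real ((y * y) ^ (y * y)))"
    using pair_modulus_pos[OF assms(1)] by (intro ln_mono) auto
  also have "\<dots> = real (y * y) * (2 * ln (real y))"
    using assms(3) by (simp add: ln_realpow ln_mult)
  finally show ?thesis by (simp add: power2_eq_square mult_ac)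
qed

text \<open>
  The primes between \<open>b\<close> and \<open>exp (b ^ 2)\<close> furnish pairs whose reciprocals sum to a quantity of
  order \<open>ln b\<close>, while the modulus stays far below \<open>exp (exp (b ^ 3))\<close>.
\<close>

lemma ex_prime_pairs_large:
  assumes "b \<ge> 1"
  shows "\<exists>M. prime_pairs b M \<and> (\<Sum>x\<in>M. 1 / real (snd x)) \<ge> (ln (real b) / 2 - 2) / 3 \<and>
    real (pair_modulus M) \<le> exp (2 * exp (2 * (real b ^ 2 + 1)) * (real b ^ 2 + 1))"
proof -
  define y where "y = nat \<lceil>exp (real b ^ 2)\<rceil>"
  have y: "exp (real b ^ 2) \<le> real y" "real y \<le> exp (real b ^ 2) + 1"
    unfolding y_def using exp_gt_zero[of "real b ^ 2"] by linarith+
  have "exp (real b ^ 2) \<ge> 1" by simp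
  then have y1: "real y \<ge> 1" using y by linarith
  have "exp (real b ^ 2) * 2 \<le> exp (real b ^ 2) * exp 1"
    using exp_ge_add_one_self[of 1] by (intro mult_left_mono) auto
  then have y2: "real y \<le> exp (real b ^ 2 + 1)"
    using y \<open>exp (real b ^ 2) \<ge> 1\<close> unfolding exp_add by linarith
  have ln_y: "real b ^ 2 \<le> ln (real y)" "ln (real y) \<le> real b ^ 2 + 1"
    using y(1) y2 y1 by (simp_all add: ln_ge_iff ln_le_iff)
  define A where "A = {p. prime p \<and> b < p \<and> p \<le> y}"
  have finA: "finite A" by (rule finite_subset[of _ "{..y}"]) (auto simp: A_def)
  have "prime p \<and> b < p" if "p \<in> A" for p using that by (simp add: A_def)
  then obtain M where M: "prime_pairs b M" "M \<subseteq> A \<times> A"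
      "(\<Sum>p\<in>A. 1 / real p) \<le> 2 + 3 * (\<Sum>x\<in>M. 1 / real (snd x))"
    using ex_prime_pairs[OF finA assms] by blast
  have "real b ^ 2 \<le> real b * exp (2 * (\<Sum>p\<in>A. 1 / real p))"
    using ln_le_exp_sum_primes[of b y] ln_y y1 assms unfolding A_def by linarith
  then have "real b \<le> exp (2 * (\<Sum>p\<in>A. 1 / real p))"
    using assms by (simp add: power2_eq_square)
  then have "ln (real b) \<le> 2 * (\<Sum>p\<in>A. 1 / real p)"
    using assms by (simp add: ln_le_iff)
  also have "\<dots> \<le> 2 * (2 + 3 * (\<Sum>x\<in>M. 1 / real (snd x)))"
    using M(3) by (rule mult_left_mono) simp
  finally have "ln (real b) \<le> 2 * (2 + 3 * (\<Sum>x\<in>M. 1 / real (snd x)))" .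
  then have 1: "(\<Sum>x\<in>M. 1 / real (snd x)) \<ge> (ln (real b) / 2 - 2) / 3" by simp
  have "M \<subseteq> {1..y} \<times> {1..y}" using M(2) by (auto simp: A_def prime_ge_1_nat)
  then have "ln (real (pair_modulus M)) \<le> 2 * real y ^ 2 * ln (real y)"
    using M(1) y1 by (intro ln_pair_modulus_le) auto
  also have "\<dots> \<le> 2 * exp (real b ^ 2 + 1) ^ 2 * (real b ^ 2 + 1)"
    using y1 y2 ln_y by (intro mult_mono power_mono) auto
  also have "exp (real b ^ 2 + 1) ^ 2 = exp (2 * (real b ^ 2 + 1))"
    by (simp add: exp_of_nat_mult flip: exp_of_nat_mult)
  finally have "real (pair_modulus M) \<le> exp (2 * exp (2 * (real b ^ 2 + 1)) * (real b ^ 2 + 1))"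
    using pair_modulus_pos[OF M(1)] by (simp add: ln_le_iff)
  with M(1) 1 show ?thesis by blast
qed

text \<open>
  With \<open>A = hit_count M\<close> and \<open>N\<close> the modulus of the system, the quantity
  \<open>A * (\<Sum>j=2..m. f_log k (N * j))\<close> approximates the sum of \<open>f_log k q\<close> over
  \<open>N < q \<le> N m\<close> with \<open>hits M q\<close>. It grows in steps of size at most \<open>1\<close> and like an
  iterated logarithm, so it passes \<open>K\<close> in a controlled place.
\<close>

lemma ex_block_length:
  assumes "N \<ge> 1" "A \<ge> 1" "K > 0" "A \<le> real N"
  obtains m where "m \<ge> 2" "K \<le> A * (\<Sum>j=2..m. f_log k (N * j))"
    "A * (\<Sum>j=2..m. f_log k (N * j)) \<le> K + 1"
    "real (N * m) \<le> 2 * iter_exp (Suc k) ((K + 2) * real N)"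
proof -
  define e where "e = iter_exp (Suc k) ((K + 2) * real N)"
  define H where "H = (\<lambda>m. A * (\<Sum>j=2..m. f_log k (N * j)))"
  have N1: "real N \<ge> 1" using assms(1) by simp
  have z: "(K + 2) * real N \<ge> 1" "(K + 2) * real N \<ge> real N"
    using assms(3) N1 mult_mono[of 1 "K + 2" 1 "real N"] by (auto simp: mult_le_cancel_right1)
  have e: "e \<ge> real N" unfolding e_def using iter_exp_ge_self z(2) by (rule order_trans[rotated])
  define m0 where "m0 = nat \<lceil>e / real N\<rceil>"
  have "e / real N \<ge> 1" using e N1 by simp
  then have m0: "e / real N \<le> real m0" "real m0 \<le> e / real N + 1"
    unfolding m0_def by linarith+
  have m0_ge: "m0 \<ge> 1" using m0 \<open>e / real N \<ge> 1\<close> by linarith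
  have e_le: "e \<le> real (N * Suc m0)"
  proof -
    have "e \<le> real m0 * real N" using m0(1) N1 by (simp add: divide_le_eq)
    also have "\<dots> \<le> real (N * Suc m0)" by (simp add: algebra_simps)
    finally show ?thesis .
  qed
  have le_e: "real (N * m0) \<le> 2 * e"
  proof -
    have "real m0 * real N \<le> (e / real N + 1) * real N" using m0(2) by (intro mult_right_mono) auto
    also have "\<dots> = e + real N" using N1 by (simp add: field_simps)
    finally show ?thesis using e by (simp add: mult.commute)
  qed
  have "H m0 \<ge> K"
  proof -
    have "(K + 2) * real N = iter_log (Suc k) e"
      unfolding e_def using z(1) by (simp only: iter_log_iter_exp)
    also have "\<dots> \<le> iter_log (Suc k) (real (N * Suc m0))"
      using e_le e N1 by (intro iter_log_mono) auto
    finally have "iter_log (Suc k) (real (N * Suc m0)) \<ge> (K + 2) * real N" .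
    moreover have "iter_log (Suc k) (real (2 * N)) \<le> 2 * real N"
      using iter_log_le_self[of "real (2 * N)" "Suc k"] N1 by simp
    ultimately have "K * real N \<le> (\<Sum>j=2..m0. real N * f_log k (N * j))"
      using sum_f_log_multiples_ge[OF assms(1) m0_ge, of k] by (simp add: algebra_simps)
    also have "\<dots> = (\<Sum>j=2..m0. f_log k (N * j)) * real N"
      by (simp add: sum_distrib_left mult.commute)
    finally have "K \<le> (\<Sum>j=2..m0. f_log k (N * j))" using N1 by simp
    also have "\<dots> = 1 * (\<Sum>j=2..m0. f_log k (N * j))" by simp
    also have "\<dots> \<le> H m0"
      unfolding H_def using assms(1,2)
      by (intro mult_right_mono sum_nonneg less_imp_le[OF f_log_pos]) auto
    finally show ?thesis .
  qed
  define m where "m = (LEAST m. H m \<ge> K)"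
  have m: "H m \<ge> K" "m \<le> m0"
    unfolding m_def using \<open>H m0 \<ge> K\<close> by (auto intro: LeastI Least_le)
  have m2: "m \<ge> 2"
  proof (rule ccontr)
    assume "\<not> m \<ge> 2"
    then have "{2..m} = {}" by auto
    then have "H m = 0" by (simp only: H_def sum.empty mult_zero_right)
    then show False using m(1) assms(3) by simp
  qed
  have "H (m - 1) < K" using not_less_Least[of "m - 1" "\<lambda>m. H m \<ge> K"] m2 by (simp add: m_def)
  moreover have "H m = H (m - 1) + A * f_log k (N * m)"
  proof -
    obtain n where "m = Suc n" using m2 by (cases m) auto
    then show ?thesis using m2 by (simp add: H_def distrib_left)
  qed
  moreover have "A * f_log k (N * m) \<le> real N * (1 / real N)"
  proof (rule mult_mono)
    have "N \<le> N * m" using m2 by simp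
    moreover have "f_log k (N * m) \<le> 1 / real (N * m)"
      using assms(1) m2 by (intro f_log_le) auto
    ultimately show "f_log k (N * m) \<le> 1 / real N"
      using N1 by (elim order_trans) (intro frac_le, auto)
    show "0 \<le> f_log k (N * m)"
      using f_log_pos[of "N * m" k] assms(1) m2 by (simp add: Suc_le_eq)
  qed (use assms in auto)
  ultimately have "H m \<le> K + 1" using N1 by simp
  moreover have "real (N * m) \<le> 2 * e"
  proof -
    have "N * m \<le> N * m0" using m(2) by simp
    then show ?thesis using le_e by linarith
  qed
  ultimately show ?thesis using that m m2 by (simp add: H_def e_def)
qed

text \<open>
  The approximation \<open>a / b\<close> of \<open>\<gamma>\<close> need not be in lowest terms, and for rational \<open>\<gamma>\<close> it cannot
  be for large \<open>b\<close>: these are then multiples of the denominator of \<open>\<gamma>\<close>.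
\<close>

lemma ex_block:
  fixes \<gamma> C K \<epsilon> :: real
  assumes freq: "\<exists>\<^sub>F b in sequentially. int_dist (real b * \<gamma>) * iter_exp (k + 3) (real b ^ 7000) < C"
    and "K > 0" "\<epsilon> > 0"
  shows "\<exists>S D. finite S \<and> S \<subseteq> {1..} \<and> K \<le> (\<Sum>q\<in>S. f_log k q) \<and>
    D \<in> lmeasurable \<and> measure lebesgue D \<le> \<epsilon> \<and>
    (\<forall>\<alpha>\<in>{0..1}. \<forall>q\<in>S. int_dist (real q * \<alpha> - \<gamma>) < f_log k q \<longrightarrow> \<alpha> \<in> D)"
proof -
  \<comment> \<open>The block ends below \<open>2 * iter_exp (Suc k) ((K + 2) * N)\<close>, and \<open>C\<close> times the power \<open>Suc k\<close>
    of this is at most \<open>iter_exp (Suc k) (d * N)\<close>.\<close>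
  define c where "c = max 1 (C * 2 ^ Suc k)"
  define d where "d = c * (real (Suc k) * (K + 2))"
  have c1: "c \<ge> 1" by (simp add: c_def)
  have d0: "d > 0" unfolding d_def using assms(2) c1 by (intro mult_pos_pos) auto
  let ?s = "\<lambda>b::nat. (ln (real b) / 2 - 2) / 3"
  let ?n = "\<lambda>b::nat. exp (2 * exp (2 * (real b ^ 2 + 1)) * (real b ^ 2 + 1))"
  have ev1: "\<forall>\<^sub>F b in sequentially. 16 / real b < \<epsilon> / 2"
  proof -
    have "((\<lambda>b::nat. 16 / real b) \<longlongrightarrow> 0) sequentially" by real_asymp
    then show ?thesis using assms(3) by (intro order_tendstoD) auto
  qed
  have ev2: "\<forall>\<^sub>F b in sequentially. exp (- ?s b / 3) < \<epsilon> / 16 / (K + 1)"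
  proof -
    have "((\<lambda>b::nat. exp (- ?s b / 3)) \<longlongrightarrow> 0) sequentially" by real_asymp
    then show ?thesis using assms(2,3) by (intro order_tendstoD) auto
  qed
  \<comment> \<open>\<open>?n b\<close> bounds the modulus \<open>N\<close>, so this gives \<open>d * N \<le> exp (exp (b ^ 3))\<close>.\<close>
  have ev3: "\<forall>\<^sub>F b in sequentially. ?n b / exp (exp (real b ^ 3)) < 1 / d"
  proof -
    have "((\<lambda>b::nat. ?n b / exp (exp (real b ^ 3))) \<longlongrightarrow> 0) sequentially" by real_asymp
    then show ?thesis using d0 by (intro order_tendstoD) auto
  qed
  have ev4: "\<forall>\<^sub>F b in sequentially. ?s b > 0" by real_asymp
  have ev5: "\<forall>\<^sub>F b in sequentially. b \<ge> (5::nat)" by (rule eventually_ge_at_top)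
  have "\<exists>\<^sub>F b in sequentially. int_dist (real b * \<gamma>) * iter_exp (k + 3) (real b ^ 7000) < C \<and>
      16 / real b < \<epsilon> / 2 \<and> exp (- ?s b / 3) < \<epsilon> / 16 / (K + 1) \<and>
      ?n b / exp (exp (real b ^ 3)) < 1 / d \<and> ?s b > 0 \<and> b \<ge> 5"
    using freq ev1 ev2 ev3 ev4 ev5 by (intro frequently_eventually_frequently eventually_conj)
  then obtain b :: nat where b: "int_dist (real b * \<gamma>) * iter_exp (k + 3) (real b ^ 7000) < C"
      "16 / real b < \<epsilon> / 2" "exp (- ?s b / 3) < \<epsilon> / 16 / (K + 1)"
      "?n b / exp (exp (real b ^ 3)) < 1 / d" "?s b > 0" "b \<ge> 5"
    by (blast dest: frequently_ex)
  obtain M where M: "prime_pairs b M" "(\<Sum>x\<in>M. 1 / real (snd x)) \<ge> ?s b"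
      "real (pair_modulus M) \<le> ?n b"
    using ex_prime_pairs_large[of b] b(6) by auto
  define N where "N = pair_modulus M"
  have "M \<noteq> {}" using M(2) b(5) by auto
  have N1: "N \<ge> 1" using pair_modulus_pos[OF M(1)] by (simp add: N_def)
  have A1: "hit_count M \<ge> 1" by (rule hit_count_ge_1[OF M(1)])
  have AN: "hit_count M / real N \<le> 2 / real b"
    unfolding N_def using M(1) \<open>M \<noteq> {}\<close> b(6) by (intro hit_count_le) auto
  also have "\<dots> \<le> 1" using b(6) by simp
  finally have "hit_count M \<le> real N" using N1 by simp
  then obtain m where m: "m \<ge> 2" "K \<le> hit_count M * (\<Sum>j=2..m. f_log k (N * j))"
      "hit_count M * (\<Sum>j=2..m. f_log k (N * j)) \<le> K + 1"
      "real (N * m) \<le> 2 * iter_exp (Suc k) ((K + 2) * real N)"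
    using ex_block_length[OF N1 A1 assms(2)] by blast
  obtain a :: int where a: "int_dist (real b * \<gamma>) = \<bar>real b * \<gamma> - real_of_int a\<bar>"
    using int_dist_attained[of "real b * \<gamma>"] by (auto elim: Ints_cases)
  obtain D where D: "D \<in> lmeasurable"
      "measure lebesgue D \<le> 8 * (hit_count M / real N + avoid_count M * (\<Sum>j=2..m. f_log k (N * j)))"
      "\<And>\<alpha> q c. \<lbrakk>\<alpha> \<in> {0..1}; N < q; q \<le> N * m; hits M q;
        \<bar>real q * \<alpha> - real_of_int a / real b - real_of_int c\<bar> < 2 * f_log k q\<rbrakk> \<Longrightarrow> \<alpha> \<in> D"
    using ex_small_cover[where f = "f_log k" and a = a, OF M(1) \<open>M \<noteq> {}\<close> b(6) m(1)
      f_log_antimono less_imp_le[OF f_log_pos] f_log_le, folded N_def] by metis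
  define S where "S = {q. N < q \<and> q \<le> N * m \<and> hits M q}"
  have finS: "finite S" by (rule finite_subset[of _ "{..N * m}"]) (auto simp: S_def)
  have sum_S: "K \<le> (\<Sum>q\<in>S. f_log k q)"
  proof -
    have "(\<Sum>q<N. of_bool (hits M q)) * (\<Sum>j=Suc 1..m. f_log k (N * j))
        \<le> (\<Sum>q\<in>{N * 1<..N * m}. f_log k q * of_bool (hits M q))"
      using N1 m(1) hits_mod[OF M(1)]
      by (intro sum_antimono_periodic(2) f_log_antimono) (auto simp: N_def)
    also have "(\<Sum>q\<in>{N * 1<..N * m}. f_log k q * of_bool (hits M q))
        = (\<Sum>q\<in>{N * 1<..N * m}. if hits M q then f_log k q else 0)"
      by (intro sum.cong) auto
    also have "\<dots> = (\<Sum>q\<in>{q \<in> {N * 1<..N * m}. hits M q}. f_log k q)"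
      by (simp only: sum.inter_filter finite_greaterThanAtMost)
    also have "{q \<in> {N * 1<..N * m}. hits M q} = S" by (auto simp: S_def)
    finally show ?thesis
      using m(2) sum_hits[OF M(1)] by (simp add: N_def numeral_2_eq_2)
  qed
  have measure_D: "measure lebesgue D \<le> \<epsilon>"
  proof -
    have "avoid_count M * (\<Sum>j=2..m. f_log k (N * j))
        \<le> (hit_count M * exp (- (\<Sum>x\<in>M. 1 / real (snd x)) / 3)) * (\<Sum>j=2..m. f_log k (N * j))"
      using avoid_count_le[OF M(1)] N1
      by (intro mult_right_mono sum_nonneg less_imp_le[OF f_log_pos]) auto
    also have "\<dots> = exp (- (\<Sum>x\<in>M. 1 / real (snd x)) / 3) * (hit_count M * (\<Sum>j=2..m. f_log k (N * j)))"
      by simp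
    also have "\<dots> \<le> exp (- ?s b / 3) * (K + 1)"
      using M(2) m(2,3) assms(2) by (intro mult_mono) auto
    also have "\<dots> \<le> \<epsilon> / 16"
    proof -
      have "K + 1 > 0" using assms(2) by simp
      then show ?thesis using b(3) by (simp only: pos_less_divide_eq less_imp_le)
    qed
    finally have "avoid_count M * (\<Sum>j=2..m. f_log k (N * j)) \<le> \<epsilon> / 16" .
    moreover have "8 * (hit_count M / real N) \<le> \<epsilon> / 2" using AN b(2) by simp
    ultimately show ?thesis using D(2) by simp
  qed
  define E where "E = iter_exp (k + 3) (real b ^ 7000)"
  have large: "C * real (N * m) ^ Suc k \<le> E"
  proof -
    let ?z = "(K + 2) * real N"
    have z1: "?z \<ge> 1" using mult_mono[of 1 "K + 2" 1 "real N"] assms(2) N1 by simp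
    have e1: "iter_exp (Suc k) ?z \<ge> 1" using iter_exp_ge_self[of ?z "Suc k"] z1 by linarith
    have "C * real (N * m) ^ Suc k \<le> max 0 C * (2 * iter_exp (Suc k) ?z) ^ Suc k"
      using m(4) by (intro mult_mono power_mono) auto
    also have "\<dots> = (max 0 C * 2 ^ Suc k) * iter_exp (Suc k) ?z ^ Suc k"
      by (simp only: power_mult_distrib mult.assoc)
    also have "\<dots> \<le> c * iter_exp (Suc k) ?z ^ Suc k"
    proof (rule mult_right_mono)
      show "max 0 C * 2 ^ Suc k \<le> c"
        using c1 by (cases "C \<ge> 0") (simp_all add: c_def)
    qed (use e1 in simp)
    also have "\<dots> \<le> c * iter_exp (Suc k) (real (Suc k) * ?z)"
      using power_iter_exp_le[OF z1, of k k] c1 by (intro mult_left_mono) auto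
    also have "\<dots> \<le> iter_exp (Suc k) (c * (real (Suc k) * ?z))"
      using c1 z1 mult_mono[of 1 "real (Suc k)" 1 ?z] by (intro iter_exp_mult_le) auto
    also have "c * (real (Suc k) * ?z) = d * real N" by (simp add: d_def)
    also have "iter_exp (Suc k) (d * real N) \<le> iter_exp (Suc k) (exp (exp (real b ^ 7000)))"
    proof (rule iter_exp_mono)
      have "d * real N \<le> d * ?n b" using M(3) d0 by (simp add: N_def)
      also have "\<dots> \<le> exp (exp (real b ^ 3))" using b(4) d0 by (simp add: field_simps)
      also have "\<dots> \<le> exp (exp (real b ^ 7000))"
        using b(6) by (simp add: power_increasing)
      finally show "d * real N \<le> exp (exp (real b ^ 7000))" .
    qed
    also have "\<dots> = E"
      using iter_exp_add[of "Suc k" 2 "real b ^ 7000"] by (simp add: E_def numeral_2_eq_2 numeral_3_eq_3 iter_exp_Suc)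
    finally show ?thesis .
  qed
  have E_pos: "E > 0"
    unfolding E_def by (simp add: numeral_3_eq_3 iter_exp_Suc)
  have close: "\<bar>\<gamma> - real_of_int a / real b\<bar> \<le> f_log k q" if q: "N < q" "q \<le> N * m" for q
  proof -
    have b0: "real b \<ge> 1" using b(6) by simp
    have "N * m > 0" using q by linarith
    then have Y: "real (N * m) ^ Suc k > 0" by (intro zero_less_power) (simp only: of_nat_0_less_iff)
    have "real b * \<gamma> - real_of_int a = (\<gamma> - real_of_int a / real b) * real b"
      using b0 by (simp add: left_diff_distrib mult.commute[of "real b" \<gamma>])
    then have "int_dist (real b * \<gamma>) = \<bar>\<gamma> - real_of_int a / real b\<bar> * real b"
      unfolding a by (simp only: abs_mult abs_of_nat)
    then have "\<bar>\<gamma> - real_of_int a / real b\<bar> \<le> int_dist (real b * \<gamma>)"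
      using b0 mult_left_mono[of 1 "real b" "\<bar>\<gamma> - real_of_int a / real b\<bar>"] by simp
    also have "\<dots> \<le> 1 / real (N * m) ^ Suc k"
    proof -
      have "int_dist (real b * \<gamma>) * E < C" using b(1) by (simp add: E_def)
      moreover have "int_dist (real b * \<gamma>) \<ge> 0" unfolding a by simp
      ultimately have "C > 0" using E_pos by (smt (verit) mult_nonneg_nonneg)
      have "int_dist (real b * \<gamma>) * (C * real (N * m) ^ Suc k) \<le> int_dist (real b * \<gamma>) * E"
        using large \<open>int_dist (real b * \<gamma>) \<ge> 0\<close> by (rule mult_left_mono)
      also have "\<dots> \<le> C" using b(1) by (simp add: E_def)
      finally have "int_dist (real b * \<gamma>) * real (N * m) ^ Suc k \<le> 1"
        using \<open>C > 0\<close> by (simp add: mult.left_commute[of _ C])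
      then show ?thesis using Y by (simp only: pos_le_divide_eq)
    qed
    also have "\<dots> \<le> 1 / real q ^ Suc k"
      using q by (intro frac_le power_mono) (auto simp del: of_nat_mult)
    also have "\<dots> \<le> f_log k q" using q by (intro f_log_ge) auto
    finally show ?thesis .
  qed
  have "\<alpha> \<in> D" if "\<alpha> \<in> {0..1}" "q \<in> S" "int_dist (real q * \<alpha> - \<gamma>) < f_log k q" for \<alpha> q
  proof -
    obtain n :: int where "int_dist (real q * \<alpha> - \<gamma>) = \<bar>real q * \<alpha> - \<gamma> - real_of_int n\<bar>"
      using int_dist_attained[of "real q * \<alpha> - \<gamma>"] by (auto elim: Ints_cases)
    then have "\<bar>real q * \<alpha> - real_of_int a / real b - real_of_int n\<bar> < 2 * f_log k q"
      using that(3) close[of q] that(2) unfolding S_def by fastforce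
    then show ?thesis using D(3)[of \<alpha> q n] that by (simp add: S_def)
  qed
  then show ?thesis
    using finS sum_S D(1) measure_D by (intro exI[of _ S] exI[of _ D]) (auto simp: S_def)
qed

section \<open>The counterexample set\<close>

theorem theorem1p6:
  fixes k :: nat and \<gamma> :: real
  assumes "Liminf sequentially
      (\<lambda>q. ereal (int_dist (real q * \<gamma>) * iter_exp (k + 3) (real q ^ 7000))) < \<infinity>"
  shows "\<exists>S \<subseteq> {1 :: nat ..}.
      (\<Sum>\<^sub>\<infinity>q\<in>S. ennreal (f_log k q)) = \<infinity> \<and>
      W_set (\<lambda>q. indicator S q * f_log k q) \<gamma> \<in> null_sets lebesgue"
proof -
  let ?F = "\<lambda>q. int_dist (real q * \<gamma>) * iter_exp (k + 3) (real q ^ 7000)"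
  obtain C :: real where C: "Liminf sequentially (\<lambda>q. ereal (?F q)) < ereal C"
    using assms ereal_dense2[OF assms] by auto
  have freq: "\<exists>\<^sub>F q in sequentially. ?F q < C"
  proof (rule ccontr)
    assume "\<not> ?thesis"
    then have "\<forall>\<^sub>F q in sequentially. ereal C \<le> ereal (?F q)"
      by (simp add: not_frequently not_less)
    then have "ereal C \<le> Liminf sequentially (\<lambda>q. ereal (?F q))" by (rule Liminf_bounded)
    with C show False by simp
  qed
  have "\<exists>S D. finite S \<and> S \<subseteq> {1..} \<and> real (Suc n) \<le> (\<Sum>q\<in>S. f_log k q) \<and>
    D \<in> lmeasurable \<and> measure lebesgue D \<le> (1 / 2) ^ n \<and>
    (\<forall>\<alpha>\<in>{0..1}. \<forall>q\<in>S. int_dist (real q * \<alpha> - \<gamma>) < f_log k q \<longrightarrow> \<alpha> \<in> D)" for n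
    using freq by (intro ex_block) auto
  then obtain S D where SD: "\<And>n. finite (S n)" "\<And>n. S n \<subseteq> {1..}"
      "\<And>n. real (Suc n) \<le> (\<Sum>q\<in>S n. f_log k q)"
      "\<And>n. D n \<in> lmeasurable" "\<And>n. measure lebesgue (D n) \<le> (1 / 2) ^ n"
      "\<And>n \<alpha> q. \<lbrakk>\<alpha> \<in> {0..1}; q \<in> S n; int_dist (real q * \<alpha> - \<gamma>) < f_log k q\<rbrakk> \<Longrightarrow> \<alpha> \<in> D n"
    by metis
  define T where "T = (\<Union>n. S n)"
  have "(\<Sum>\<^sub>\<infinity>q\<in>T. ennreal (f_log k q)) = \<infinity>"
  proof (rule ccontr)
    assume "\<not> ?thesis"
    then obtain r where r: "(\<Sum>\<^sub>\<infinity>q\<in>T. ennreal (f_log k q)) = ennreal r" "r \<ge> 0"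
      by (cases "\<Sum>\<^sub>\<infinity>q\<in>T. ennreal (f_log k q)") auto
    obtain n where n: "r < real n" using reals_Archimedean2 by blast
    have "ennreal (real (Suc n)) \<le> ennreal (\<Sum>q\<in>S n. f_log k q)"
      by (rule ennreal_leI[OF SD(3)])
    also have "\<dots> = (\<Sum>q\<in>S n. ennreal (f_log k q))"
      using SD(2)[of n] by (intro sum_ennreal[symmetric] less_imp_le[OF f_log_pos]) auto
    also have "\<dots> = (\<Sum>\<^sub>\<infinity>q\<in>S n. ennreal (f_log k q))"
      using SD(1) by simp
    also have "\<dots> \<le> (\<Sum>\<^sub>\<infinity>q\<in>T. ennreal (f_log k q))"
      by (intro infsum_mono_neutral nonneg_summable_on_complete) (auto simp: T_def)
    finally have "ennreal (real (Suc n)) \<le> ennreal r" by (simp only: r(1))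
    then have "real (Suc n) \<le> r" using r(2) by (simp only: ennreal_le_iff)
    with n show False by simp
  qed
  moreover have "W_set (\<lambda>q. indicator T q * f_log k q) \<gamma> \<in> null_sets lebesgue"
  proof -
    have "limsup D \<in> null_sets lebesgue"
    proof (rule borel_cantelli_limsup1)
      show "summable (\<lambda>n. measure lebesgue (D n))"
        by (rule summable_comparison_test'[of "\<lambda>n. (1 / 2) ^ n" 0])
           (use SD(5) in \<open>auto intro!: summable_geometric\<close>)
      show "emeasure lebesgue (D n) < \<infinity>" for n
        using fmeasurableD2[OF SD(4)[of n]] by (simp only: infinity_ennreal_def less_top)
    qed (use SD(4) in auto)
    moreover have "W_set (\<lambda>q. indicator T q * f_log k q) \<gamma> \<subseteq> limsup D"
    proof
      fix \<alpha> assume "\<alpha> \<in> W_set (\<lambda>q. indicator T q * f_log k q) \<gamma>"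
      then have \<alpha>: "\<alpha> \<in> {0..1}"
        and inf: "infinite {q. q \<ge> 1 \<and> int_dist (real q * \<alpha> - \<gamma>) < indicator T q * f_log k q}"
          (is "infinite ?Q") by (auto simp: W_set_def)
      have "\<exists>n\<ge>m. \<alpha> \<in> D n" for m
      proof -
        \<comment> \<open>The first \<open>m\<close> blocks are finite, so some \<open>q\<close> in \<open>?Q\<close> belongs to a later one.\<close>
        have "\<not> ?Q \<subseteq> (\<Union>n<m. S n)"
          using inf SD(1) by (meson finite_UN_I finite_lessThan finite_subset)
        then obtain q where q: "int_dist (real q * \<alpha> - \<gamma>) < indicator T q * f_log k q"
          "q \<notin> (\<Union>n<m. S n)" by blast
        have "int_dist (real q * \<alpha> - \<gamma>) \<ge> 0"
          using int_dist_attained[of "real q * \<alpha> - \<gamma>"] by auto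
        then have "q \<in> T" using q(1) by (cases "q \<in> T") auto
        then obtain n where "q \<in> S n" by (auto simp: T_def)
        moreover from this have "n \<ge> m" using q(2) by (auto simp: not_less)
        ultimately show ?thesis using SD(6)[OF \<alpha>, of q n] q(1) \<open>q \<in> T\<close> by auto
      qed
      then show "\<alpha> \<in> limsup D" by (auto simp: limsup_INF_SUP)
    qed
    ultimately show ?thesis
      by (rule null_sets_completion_subset[rotated])
  qed
  moreover have "T \<subseteq> {1..}" using SD(2) by (auto simp: T_def)
  ultimately show ?thesis by blast
qed

end
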